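(* Let $f,g,c$ satisfy the standing assumption on the composite problem (P), $\min_x\Phi(x)=f(x)+g(c(x))$, and let the value function $\mathcal V(u)=\inf_x\{f(x)+g(c(x)-u)\}$, $u\in\mathbb R^m$, be proper and lower semicontinuous. Let $\{(x^k,z^k,y^k,\hat y^k)\}$ be a sequence generated by the safeguarded augmented Lagrangian method (described in the context) such that $\sum_{k=0}^\infty\sqrt{\varepsilon_k/\mu_k}<\infty$. Then $$\sum_{k=0}^\infty\mu_k\|y^{k+1}-y^k\|^2<\infty,\qquad\sum_{k=0}^\infty\mu_k\|\hat y^{k+1}-\hat y^k\|^2<\infty$$ and, particularly, $\mu_k(y^{k+1}-y^k)\to0$ and $\mu_k(\hat y^{k+1}-\hat y^k)\to0$. Moreover, each accumulation point of $\{y^k\}$ is a solution of the convex optimization problem $$\text{minimize}_{y\in\mathbb R^m}\quad -d(y)+\frac\mu2\operatorname{dist}_S^2(y),$$ where $\mu\ge0$ is the limit of the nonincreasing sequence $\{\mu_k\}$ and $d$ is the Lagrange dual function of (P).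
   Context: Spaces $\mathbb R^n,\mathbb R^m$ carry the Euclidean inner product $\langle\cdot,\cdot\rangle$ and norm $\|\cdot\|$; $\overline{\mathbb R}=\mathbb R\cup\{+\infty\}$. For a proper lsc convex $g:\mathbb R^m\to\overline{\mathbb R}$, the horizon is $\operatorname{hzn} g=\{v\in\mathbb R^m : g(z+v)\le g(z)\ \forall z\in\operatorname{dom} g\}$ and $g^*$ is the convex conjugate. Standing assumption: $f:\mathbb R^n\to\mathbb R$ is continuously differentiable and convex; $g:\mathbb R^m\to\overline{\mathbb R}$ is proper, lsc, convex; $c:\mathbb R^n\to\mathbb R^m$ is continuously differentiable and $(-\operatorname{hzn} g)$-convex, i.e. $c(\lambda x+(1-\lambda)x')-\lambda c(x)-(1-\lambda)c(x')\in\operatorname{hzn} g$ for all $x,x'\in\mathbb R^n$, $\lambda\in[0,1]$; (P) is feasible and possesses a minimizer. Lagrangian: $L(x,y)=f(x)+\langle y,c(x)\rangle-g^*(y)$. Dual function: $d(y)=\inf_xL(x,y)\in\mathbb R\cup\{-\infty\}$. Augmented Lagrangian for $\mu>0$: $L_\mu(x,y)=f(x)+g^\mu(c(x)+\mu y)-\frac\mu2\|y\|^2$, where $g^\mu(z)=\inf_w\{g(w)+\frac1{2\mu}\|w-z\|^2\}$. $\operatorname{prox}_\varphi(z)$ is the unique minimizer of $w\mapsto\varphi(w)+\frac12\|w-z\|^2$; $\operatorname{proj}_S$ and $\operatorname{dist}_S$ are the Euclidean projection onto and distance to $S$. Safeguarded ALM. Data: $y^0\in\mathbb R^m$; $\mu_0>0$;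 nonempty, convex, compact set $S\subseteq\mathbb R^m$; $\beta\in(0,1)$. For $k=0,1,2,\dots$: set $\hat y^k=\operatorname{proj}_S(y^k)$; select $\varepsilon_k\ge0$ and $x^k\in\mathbb R^n$ with $L_{\mu_k}(x^k,\hat y^k)\le\inf_xL_{\mu_k}(x,\hat y^k)+\varepsilon_k$; set $z^k=\operatorname{prox}_{\mu_kg}(c(x^k)+\mu_k\hat y^k)$; set $y^{k+1}=\hat y^k+\mu_k^{-1}(c(x^k)-z^k)$; set $\mu_{k+1}=\beta_k\mu_k$ for some $\beta_k\in(0,\beta]\cup\{1\}$. *)

theory Defs
  imports "HOL-Analysis.Analysis"
begin

text \<open>
  Extended-real-valued functions have codomain \<^typ>\<open>ereal\<close>. Functions into the reals extended
  by plus infinity only are those which in addition never take the value minus infinity.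
\<close>

definition effdom :: "('a \<Rightarrow> ereal) \<Rightarrow> 'a set" where
  "effdom \<phi> = {z. \<phi> z < \<infinity>}"

definition proper_fun :: "('a \<Rightarrow> ereal) \<Rightarrow> bool" where
  "proper_fun \<phi> \<longleftrightarrow> (\<forall>z. \<phi> z \<noteq> -\<infinity>) \<and> effdom \<phi> \<noteq> {}"

definition lsc_fun :: "('a::topological_space \<Rightarrow> ereal) \<Rightarrow> bool" where
  "lsc_fun \<phi> \<longleftrightarrow> (\<forall>z. \<phi> z \<le> Liminf (at z) \<phi>)"

text \<open>
  The extended-real analogue of \<^const>\<open>convex_on\<close>. It is meant for functions that
  avoid minus infinity, so that no undefined sums arise; note that \<^prop>\<open>0 * (\<infinity>::ereal) = 0\<close>.
\<close>

definition convex_fun :: "('a::real_vector \<Rightarrow> ereal) \<Rightarrow> bool" where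
  "convex_fun \<phi> \<longleftrightarrow> (\<forall>z z'. \<forall>u\<ge>0. \<forall>v\<ge>0. u + v = 1 \<longrightarrow>
     \<phi> (u *\<^sub>R z + v *\<^sub>R z') \<le> ereal u * \<phi> z + ereal v * \<phi> z')"

text \<open>A minimizer has to be a feasible point: a function that is identically plus infinity has none.\<close>

definition is_minimizer :: "('a \<Rightarrow> ereal) \<Rightarrow> 'a \<Rightarrow> bool" where
  "is_minimizer \<phi> z \<longleftrightarrow> z \<in> effdom \<phi> \<and> (\<forall>w. \<phi> z \<le> \<phi> w)"

definition cont_differentiable ::
    "('a::real_normed_vector \<Rightarrow> 'b::real_normed_vector) \<Rightarrow> bool" where
  "cont_differentiable h \<longleftrightarrow>
     (\<exists>h' :: 'a \<Rightarrow> 'a \<Rightarrow>\<^sub>L 'b. (\<forall>x. (h has_derivative blinfun_apply (h' x)) (at x)) \<and>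
        continuous_on UNIV h')"

definition hzn :: "('a::real_vector \<Rightarrow> ereal) \<Rightarrow> 'a set" where
  "hzn g = {v. \<forall>z\<in>effdom g. g (z + v) \<le> g z}"

text \<open>Convexity of \<open>c\<close> with respect to the cone \<open>-K\<close>.\<close>

definition neg_cone_convex ::
    "'b set \<Rightarrow> ('a::real_vector \<Rightarrow> 'b::real_vector) \<Rightarrow> bool" where
  "neg_cone_convex K c \<longleftrightarrow> (\<forall>x x'. \<forall>l\<in>{0..1}.
     c (l *\<^sub>R x + (1 - l) *\<^sub>R x') - l *\<^sub>R c x - (1 - l) *\<^sub>R c x' \<in> K)"

definition conjugate :: "('a::real_inner \<Rightarrow> ereal) \<Rightarrow> 'a \<Rightarrow> ereal" where
  "conjugate g y = (SUP z. ereal (y \<bullet> z) - g z)"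

definition prox :: "('a::real_normed_vector \<Rightarrow> ereal) \<Rightarrow> 'a \<Rightarrow> 'a" where
  "prox \<phi> z = (THE w. is_minimizer (\<lambda>w. \<phi> w + ereal (1 / 2 * (norm (w - z))\<^sup>2)) w)"

definition moreau_env :: "real \<Rightarrow> ('a::real_normed_vector \<Rightarrow> ereal) \<Rightarrow> 'a \<Rightarrow> ereal" where
  "moreau_env \<mu> g z = (INF w. g w + ereal (1 / (2 * \<mu>) * (norm (w - z))\<^sup>2))"

definition composite_obj ::
    "('a \<Rightarrow> real) \<Rightarrow> ('b \<Rightarrow> ereal) \<Rightarrow> ('a \<Rightarrow> 'b) \<Rightarrow> 'a \<Rightarrow> ereal" where
  "composite_obj f g c x = ereal (f x) + g (c x)"

definition value_fun ::
    "('a \<Rightarrow> real) \<Rightarrow> ('b::real_vector \<Rightarrow> ereal) \<Rightarrow> ('a \<Rightarrow> 'b) \<Rightarrow> 'b \<Rightarrow> ereal" where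
  "value_fun f g c u = (INF x. ereal (f x) + g (c x - u))"

definition lagrangian ::
    "('a \<Rightarrow> real) \<Rightarrow> ('b::real_inner \<Rightarrow> ereal) \<Rightarrow> ('a \<Rightarrow> 'b) \<Rightarrow> 'a \<Rightarrow> 'b \<Rightarrow> ereal" where
  "lagrangian f g c x y = ereal (f x) + ereal (y \<bullet> c x) - conjugate g y"

definition dual_fun ::
    "('a \<Rightarrow> real) \<Rightarrow> ('b::real_inner \<Rightarrow> ereal) \<Rightarrow> ('a \<Rightarrow> 'b) \<Rightarrow> 'b \<Rightarrow> ereal" where
  "dual_fun f g c y = (INF x. lagrangian f g c x y)"

definition aug_lagrangian ::
    "('a \<Rightarrow> real) \<Rightarrow> ('b::real_normed_vector \<Rightarrow> ereal) \<Rightarrow> ('a \<Rightarrow> 'b) \<Rightarrow> real \<Rightarrow> 'a \<Rightarrow> 'b \<Rightarrow> ereal" where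
  "aug_lagrangian f g c \<mu> x y =
     ereal (f x) + moreau_env \<mu> g (c x + \<mu> *\<^sub>R y) - ereal (\<mu> / 2 * (norm y)\<^sup>2)"

text \<open>
  \<open>safeguarded_alm f g c S \<beta> x z y yh \<epsilon> \<mu>\<close>: with safeguarding set \<open>S\<close> and parameter \<open>\<beta>\<close>, the
  method may generate the iterates \<open>x\<close>, \<open>z\<close>, \<open>y\<close>, \<open>yh\<close> (the safeguarded multipliers) with
  tolerances \<open>\<epsilon>\<close> and penalty parameters \<open>\<mu>\<close>. The starting data are \<open>y 0\<close> and \<open>\<mu> 0\<close>.
\<close>

definition safeguarded_alm ::
    "('a \<Rightarrow> real) \<Rightarrow> ('b::euclidean_space \<Rightarrow> ereal) \<Rightarrow> ('a \<Rightarrow> 'b) \<Rightarrow> 'b set \<Rightarrow> real \<Rightarrow>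
     (nat \<Rightarrow> 'a) \<Rightarrow> (nat \<Rightarrow> 'b) \<Rightarrow> (nat \<Rightarrow> 'b) \<Rightarrow> (nat \<Rightarrow> 'b) \<Rightarrow> (nat \<Rightarrow> real) \<Rightarrow> (nat \<Rightarrow> real) \<Rightarrow> bool"
  where
  "safeguarded_alm f g c S \<beta> x z y yh \<epsilon> \<mu> \<longleftrightarrow>
     S \<noteq> {} \<and> convex S \<and> compact S \<and> 0 < \<beta> \<and> \<beta> < 1 \<and> 0 < \<mu> 0 \<and>
     (\<forall>k. yh k = closest_point S (y k) \<and>
          0 \<le> \<epsilon> k \<and>
          aug_lagrangian f g c (\<mu> k) (x k) (yh k)
            \<le> (INF x'. aug_lagrangian f g c (\<mu> k) x' (yh k)) + ereal (\<epsilon> k) \<and>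
          z k = prox (\<lambda>w. ereal (\<mu> k) * g w) (c (x k) + \<mu> k *\<^sub>R yh k) \<and>
          y (Suc k) = yh k + (1 / \<mu> k) *\<^sub>R (c (x k) - z k) \<and>
          (\<exists>\<beta>k \<in> {0<..\<beta>} \<union> {1}. \<mu> (Suc k) = \<beta>k * \<mu> k))"

definition accumulation_point :: "(nat \<Rightarrow> 'a::topological_space) \<Rightarrow> 'a \<Rightarrow> bool" where
  "accumulation_point s l \<longleftrightarrow> (\<exists>r :: nat \<Rightarrow> nat. strict_mono r \<and> (s \<circ> r) \<longlonglongrightarrow> l)"

definition penalized_dual_obj ::
    "('a \<Rightarrow> real) \<Rightarrow> ('b::real_inner \<Rightarrow> ereal) \<Rightarrow> ('a \<Rightarrow> 'b) \<Rightarrow> 'b set \<Rightarrow> real \<Rightarrow> 'b \<Rightarrow> ereal" where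
  "penalized_dual_obj f g c S \<mu> y = - dual_fun f g c y + ereal (\<mu> / 2 * (infdist y S)\<^sup>2)"

end

theory Submission
  imports Defs
begin

text \<open>
  Since \<open>-d\<close> is the conjugate of \<open>u \<mapsto> V (-u)\<close>, an exact step of the method maps \<open>yh k\<close> to the
  proximal point \<open>Y k\<close> of \<open>-d\<close> with parameter \<open>1 / \<mu> k\<close>: properness, convexity and lower
  semicontinuity of \<open>V\<close> give a minimizer of \<open>V v + \<parallel>v + \<mu> yh\<parallel>\<^sup>2 / (2\<mu>)\<close>, from which \<open>Y k\<close> and
  a subgradient of \<open>-d\<close> at \<open>Y k\<close> are read off. Strong convexity bounds the error of an inexact step,
  \<open>\<parallel>y (k+1) - Y k\<parallel> \<le> sqrt (2 \<epsilon> k / \<mu> k)\<close>. As \<open>yh k\<close> is the projection of \<open>y k\<close>, the method is an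
  inexact proximal gradient method for \<open>F k = -d + \<mu> k / 2 * dist\<^sup>2\<close> with step \<open>1 / \<mu> k\<close>. The gap
  \<open>a k = F k (Y k) - b\<close> to a lower bound \<open>b\<close> of \<open>-d\<close> obeys
  \<open>a (k+1) + \<mu> (k+1) / 2 * \<parallel>Y (k+1) - Y k\<parallel>\<^sup>2 \<le> (sqrt (a k) + e k)\<^sup>2\<close> with \<open>e\<close> summable, so \<open>a\<close> is bounded
  and the squared differences are summable. Minimality of accumulation points follows by passing to
  the limit in the subgradient inequality; if \<open>\<mu>\<close> tends to \<open>0\<close>, the differences need not tend to
  \<open>0\<close>, but compactness of \<open>S\<close> makes the proximal term vanish.
\<close>

section \<open>Proximal points of extended-real convex functions\<close>

lemma lsc_fun_open_superlevel:
  assumes "lsc_fun \<phi>"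
  shows "open {z. C < \<phi> z}"
proof (subst open_subopen, rule ballI)
  fix z assume "z \<in> {z. C < \<phi> z}"
  then have "C < \<phi> z" by simp
  moreover have "C < Liminf (at z) \<phi>"
    using assms calculation unfolding lsc_fun_def by (blast intro: less_le_trans)
  \<comment> \<open>The filter \<open>at z\<close> leaves out \<open>z\<close> itself; the assumed
    inequality at \<open>z\<close> fills the gap and turns it into \<open>nhds z\<close>.\<close>
  ultimately have "eventually (\<lambda>v. C < \<phi> v) (nhds z)"
    by (simp add: eventually_nhds_conv_at less_LiminfD)
  then show "\<exists>T. open T \<and> z \<in> T \<and> T \<subseteq> {z. C < \<phi> z}"
    unfolding eventually_nhds by blast
qed

text \<open>A sum exceeds \<open>C\<close> exactly when some real \<open>B\<close> splits the
  inequality into \<open>B < \<phi> z\<close> and \<open>C - B < q z\<close>. The superlevel set is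
  thus a union of intersections of open sets.\<close>

lemma open_superlevel_add_continuous:
  fixes q :: "'a::topological_space \<Rightarrow> real"
  assumes lsc: "lsc_fun \<phi>" and fin: "\<And>z. \<phi> z \<noteq> -\<infinity>" and q: "continuous_on UNIV q"
  shows "open {z. ereal C < \<phi> z + ereal (q z)}"
proof -
  have "{z. ereal C < \<phi> z + ereal (q z)} = (\<Union>B. {z. ereal B < \<phi> z} \<inter> {z. C - B < q z})"
  proof (rule set_eqI, rule iffI)
    fix z assume z: "z \<in> {z. ereal C < \<phi> z + ereal (q z)}"
    show "z \<in> (\<Union>B. {z. ereal B < \<phi> z} \<inter> {z. C - B < q z})"
    proof (cases "\<phi> z")
      case (real p)
      \<comment> \<open>The level \<open>B\<close> lies below \<open>\<phi> z = p\<close> by half of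
        the slack \<open>p + q z - C\<close>, so both strict inequalities keep the other
        half.\<close>
      then have "p - (p + q z - C) / 2 < p" "C - (p - (p + q z - C) / 2) < q z"
        using z by (auto simp: field_simps)
      then show ?thesis using real by (auto intro!: exI[of _ "p - (p + q z - C) / 2"])
    next
      case PInf
      then show ?thesis by (auto intro!: exI[of _ "C - q z + 1"])
    qed (use fin in auto)
  next
    fix z assume "z \<in> (\<Union>B. {z. ereal B < \<phi> z} \<inter> {z. C - B < q z})"
    then obtain B where "ereal B < \<phi> z" "C - B < q z" by auto
    then show "z \<in> {z. ereal C < \<phi> z + ereal (q z)}"
      by (cases "\<phi> z") auto
  qed
  moreover have "open {z. C - B < q z}" for B
    by (rule open_Collect_less) (use q in auto)
  ultimately show ?thesis
    using lsc_fun_open_superlevel[OF lsc] by (simp add: open_UN open_Int)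
qed

text \<open>Without a minimum, every \<open>w\<close> in \<open>K\<close> is beaten by some
  \<open>s w\<close> in \<open>K\<close> with a real level \<open>C w\<close> strictly between the
  two values. The superlevel sets of these levels cover \<open>K\<close>. In a finite subcover take
  \<open>w\<close> with the smallest level: \<open>s w\<close> lies in some piece, whose level is
  then smaller still. The hypothesis speaks of open superlevel sets so that it applies directly to a
  function plus a continuous term.\<close>

lemma compact_attains_min_of_open_superlevel:
  fixes \<psi> :: "'a::topological_space \<Rightarrow> ereal"
  assumes K: "compact K" "K \<noteq> {}" and lsc: "\<And>C::real. open {z. ereal C < \<psi> z}"
  shows "\<exists>w\<in>K. \<forall>v\<in>K. \<psi> w \<le> \<psi> v"
proof (rule ccontr)
  assume "\<not> ?thesis"
  then have "\<forall>w\<in>K. \<exists>v C. v \<in> K \<and> \<psi> v < ereal C \<and> ereal C < \<psi> w"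
    by (meson not_le ereal_dense2)
  then obtain s C where s: "\<And>w. w \<in> K \<Longrightarrow> s w \<in> K \<and> \<psi> (s w) < ereal (C w) \<and> ereal (C w) < \<psi> w"
    by metis
  have "K \<subseteq> (\<Union>w\<in>K. {v. ereal (C w) < \<psi> v})" using s by auto
  then obtain F where F: "F \<subseteq> K" "finite F" "K \<subseteq> (\<Union>w\<in>F. {v. ereal (C w) < \<psi> v})"
    using compactE_image[OF K(1), of K "\<lambda>w. {v. ereal (C w) < \<psi> v}"] lsc by blast
  have "F \<noteq> {}" using F K by auto
  then obtain w where w: "w \<in> F" "\<And>v. v \<in> F \<Longrightarrow> C w \<le> C v"
    using F(2) by (metis arg_min_if_finite(1) arg_min_least)
  then obtain v where "v \<in> F" "ereal (C v) < \<psi> (s w)"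
    using F s by blast
  then have "ereal (C v) < ereal (C w)" using s[of w] w(1) F(1) by (meson less_trans subsetD)
  then show False using w(2)[OF \<open>v \<in> F\<close>] by simp
qed

section \<open>Extended-real convexity in terms of real bounds\<close>

lemma convex_fun_real_bound:
  assumes "convex_fun \<phi>" "\<phi> z \<le> ereal p" "\<phi> z' \<le> ereal q" "0 \<le> u" "0 \<le> v" "u + v = 1"
  shows "\<phi> (u *\<^sub>R z + v *\<^sub>R z') \<le> ereal (u * p + v * q)"
proof -
  have "\<phi> (u *\<^sub>R z + v *\<^sub>R z') \<le> ereal u * \<phi> z + ereal v * \<phi> z'"
    using assms unfolding convex_fun_def by blast
  also have "\<dots> \<le> ereal u * ereal p + ereal v * ereal q"
    using assms by (intro add_mono ereal_mult_left_mono) auto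
  finally show ?thesis by simp
qed

text \<open>With positive weights an infinite value makes the right-hand side infinite, and a zero
  weight gives equality because \<open>0 * \<infinity> = 0\<close>. Only finite values and positive
  weights remain.\<close>

lemma convex_funI:
  assumes nMInf: "\<And>z. \<phi> z \<noteq> -\<infinity>"
    and le: "\<And>z z' p q u v. \<lbrakk>\<phi> z = ereal p; \<phi> z' = ereal q; 0 < u; 0 < v; u + v = 1\<rbrakk> \<Longrightarrow>
      \<phi> (u *\<^sub>R z + v *\<^sub>R z') \<le> ereal (u * p + v * q)"
  shows "convex_fun \<phi>"
  unfolding convex_fun_def
proof (intro allI impI)
  fix z z' and u v :: real
  assume uv: "0 \<le> u" "0 \<le> v" "u + v = 1"
  show "\<phi> (u *\<^sub>R z + v *\<^sub>R z') \<le> ereal u * \<phi> z + ereal v * \<phi> z'"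
  proof (cases "u = 0 \<or> v = 0")
    case True
    then show ?thesis using uv by (auto simp flip: zero_ereal_def one_ereal_def)
  next
    case False
    then have "0 < u" "0 < v" using uv by auto
    then show ?thesis
      using le[of z _ z' _ u v] nMInf[of z] nMInf[of z'] uv(3) by (cases "\<phi> z"; cases "\<phi> z'") auto
  qed
qed

section \<open>Existence of proximal points and the Moreau envelope\<close>

lemma proper_fun_real:
  assumes "proper_fun \<phi>" "\<phi> z < \<infinity>"
  obtains p where "\<phi> z = ereal p"
  using assms unfolding proper_fun_def by (cases "\<phi> z") auto

text \<open>The minimum \<open>m\<close> over the unit ball around \<open>z0\<close> bounds the
  value where the segment from \<open>z0\<close> to \<open>v\<close> meets the unit sphere.
  Convexity along the segment extrapolates this bound to \<open>v\<close> with slope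
  \<open>r0 - m\<close>. The result takes the place of an affine minorant.\<close>

lemma proper_lsc_convex_linear_lower_bound:
  fixes \<phi> :: "'a::euclidean_space \<Rightarrow> ereal"
  assumes pr: "proper_fun \<phi>" and lsc: "lsc_fun \<phi>" and cvx: "convex_fun \<phi>"
    and z0: "\<phi> z0 = ereal r0"
  shows "\<exists>A\<ge>0. \<forall>v. 1 \<le> norm (v - z0) \<longrightarrow> ereal (r0 - A * norm (v - z0)) \<le> \<phi> v"
proof -
  have "\<exists>w\<in>cball z0 1. \<forall>v\<in>cball z0 1. \<phi> w \<le> \<phi> v"
    by (intro compact_attains_min_of_open_superlevel lsc_fun_open_superlevel[OF lsc]) auto
  then obtain w where w: "\<And>v. v \<in> cball z0 1 \<Longrightarrow> \<phi> w \<le> \<phi> v" by blast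
  have "\<phi> w \<le> \<phi> z0" using w by simp
  then have "\<phi> w < \<infinity>" using z0 by auto
  then obtain m where m: "\<phi> w = ereal m" using proper_fun_real[OF pr] by blast
  have mr: "m \<le> r0" using \<open>\<phi> w \<le> \<phi> z0\<close> z0 m by simp
  have "ereal (r0 - (r0 - m) * norm (v - z0)) \<le> \<phi> v" if v: "1 \<le> norm (v - z0)" for v
  proof (cases "\<phi> v")
    case (real p)
    define s where "s = 1 / norm (v - z0)"
    have s: "0 < s" "s \<le> 1" using v by (auto simp: s_def divide_le_eq_1 intro: less_le_trans)
    have "(1 - s) *\<^sub>R z0 + s *\<^sub>R v = z0 + s *\<^sub>R (v - z0)" by (simp add: algebra_simps)
    moreover have "z0 + s *\<^sub>R (v - z0) \<in> cball z0 1" using v by (auto simp: dist_norm s_def)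
    ultimately have "\<phi> w \<le> ereal ((1 - s) * r0 + s * p)"
      using w[of "z0 + s *\<^sub>R (v - z0)"] convex_fun_real_bound[OF cvx, of z0 r0 v p "1 - s" s] s z0 real
      by (simp add: order_trans)
    then have "m \<le> (1 - s) * r0 + s * p" using m by simp
    then have "m * norm (v - z0) \<le> ((1 - s) * r0 + s * p) * norm (v - z0)"
      by (rule mult_right_mono) simp
    also have "\<dots> = (norm (v - z0) - 1) * r0 + p"
      using v unfolding s_def by (auto simp: field_simps)
    finally show ?thesis using real by (simp add: algebra_simps)
  qed (use pr in \<open>auto simp: proper_fun_def\<close>)
  then show ?thesis using mr by (intro exI[of _ "r0 - m"]) auto
qed

text \<open>The point \<open>w\<close> minimizes \<open>\<phi>\<close> plus the quadratic
  \<open>q\<close> centred at \<open>a\<close>. Linear decay of \<open>\<phi>\<close> is beaten by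
  \<open>q\<close>, so a minimizer over a large ball is global. First-order optimality along
  segments from \<open>w\<close> then makes \<open>(a - w) / \<tau>\<close> a subgradient of
  \<open>\<phi>\<close> at \<open>w\<close>.\<close>

lemma prox_exists_subgradient:
  fixes \<phi> :: "'a::euclidean_space \<Rightarrow> ereal"
  assumes pr: "proper_fun \<phi>" and lsc: "lsc_fun \<phi>" and cvx: "convex_fun \<phi>" and lam: "0 < \<tau>"
  obtains w r where "\<phi> w = ereal r" "\<And>v. ereal (r + (a - w) \<bullet> (v - w) / \<tau>) \<le> \<phi> v"
proof -
  obtain z0 where "\<phi> z0 < \<infinity>" using pr unfolding proper_fun_def effdom_def by auto
  then obtain r0 where z0: "\<phi> z0 = ereal r0" using proper_fun_real[OF pr] by blast
  obtain A where A: "A \<ge> 0" "\<And>v. 1 \<le> norm (v - z0) \<Longrightarrow> ereal (r0 - A * norm (v - z0)) \<le> \<phi> v"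
    using proper_lsc_convex_linear_lower_bound[OF pr lsc cvx z0] by blast
  define q where "q v = (norm (v - a))\<^sup>2 / (2 * \<tau>)" for v
  \<comment> \<open>If \<open>d\<close>, the distance from \<open>v\<close> to \<open>z0\<close>,
    exceeds \<open>R\<close>, then \<open>d * d\<close> is at least
    \<open>(2 * b + 2 * \<tau> * A) * d\<close> with \<open>b\<close> the distance from
    \<open>z0\<close> to \<open>a\<close>, which lets \<open>q\<close> absorb the linear term. The
    summand 1 keeps \<open>v\<close> outside the unit ball, where the linear bound holds.\<close>
  define R where "R = 2 * norm (z0 - a) + 2 * \<tau> * A + 1"
  have R: "R \<ge> 1" using A lam by (simp add: R_def)
  have "continuous_on UNIV q" unfolding q_def by (intro continuous_intros) (use lam in auto)
  then have "open {z. ereal C < \<phi> z + ereal (q z)}" for C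
    using open_superlevel_add_continuous[OF lsc] pr unfolding proper_fun_def by blast
  then obtain w where w: "w \<in> cball z0 R"
      and wmin: "\<And>v. v \<in> cball z0 R \<Longrightarrow> \<phi> w + ereal (q w) \<le> \<phi> v + ereal (q v)"
    using compact_attains_min_of_open_superlevel[of "cball z0 R" "\<lambda>z. \<phi> z + ereal (q z)"] R by auto
  have "z0 \<in> cball z0 R" using R by simp
  from wmin[OF this] have wz0: "\<phi> w + ereal (q w) \<le> ereal (r0 + q z0)" using z0 by simp
  then have "\<phi> w < \<infinity>" by (cases "\<phi> w") auto
  then obtain r where r: "\<phi> w = ereal r" using proper_fun_real[OF pr] by blast
  have glob: "r + q w \<le> p + q v" if p: "\<phi> v = ereal p" for v p
  proof (cases "v \<in> cball z0 R")
    case True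
    then show ?thesis using wmin[OF True] r p by simp
  next
    case False
    define d where "d = norm (v - z0)"
    define b where "b = norm (z0 - a)"
    have d: "d \<ge> 2 * b + 2 * \<tau> * A + 1" "d \<ge> 1"
      using False R by (auto simp: d_def b_def R_def dist_norm norm_minus_commute)
    have pb: "r0 - A * d \<le> p" using A(2)[of v] d p by (simp add: d_def)
    have "d \<le> norm (v - a) + b" unfolding d_def b_def
      using norm_triangle_ineq4[of "v - a" "z0 - a"] by simp
    moreover have "b \<ge> 0" "d - b \<ge> 0" using d A lam by (auto simp: b_def intro: order_trans[rotated])
    ultimately have "(d - b)\<^sup>2 \<le> (norm (v - a))\<^sup>2" by (intro power_mono) auto
    moreover have "2 * \<tau> * A * d + b\<^sup>2 \<le> (d - b)\<^sup>2"
    proof -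
      have "(2 * b + 2 * \<tau> * A) * d \<le> d * d" using d by (intro mult_right_mono) auto
      then show ?thesis by (simp add: power2_eq_square algebra_simps)
    qed
    ultimately have "(2 * \<tau> * A * d + b\<^sup>2) / (2 * \<tau>) \<le> q v"
      unfolding q_def using lam by (intro divide_right_mono) auto
    then have "A * d + q z0 \<le> q v" unfolding q_def b_def using lam by (simp add: add_divide_distrib)
    then show ?thesis using wz0 r pb by simp
  qed
  have "ereal (r + (a - w) \<bullet> (v - w) / \<tau>) \<le> \<phi> v" for v
  proof (cases "\<phi> v")
    case (real p)
    have q_step: "q (w + t *\<^sub>R (v - w)) = q w - t * ((a - w) \<bullet> (v - w) / \<tau>) + t\<^sup>2 * (norm (v - w))\<^sup>2 / (2 * \<tau>)"
      for t
    proof -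
      have "w + t *\<^sub>R (v - w) - a = (w - a) + t *\<^sub>R (v - w)" by simp
      then have "(norm (w + t *\<^sub>R (v - w) - a))\<^sup>2 =
          (norm (w - a))\<^sup>2 - 2 * t * ((a - w) \<bullet> (v - w)) + t\<^sup>2 * (norm (v - w))\<^sup>2"
        unfolding power2_norm_eq_inner by (simp add: algebra_simps power2_eq_square inner_commute)
      then show ?thesis unfolding q_def using lam by (simp add: field_simps)
    qed
    \<comment> \<open>Minimality of \<open>w\<close> is tested at
      \<open>w + t *\<^sub>R (v - w)\<close>. After division by \<open>t\<close> the quadratic
      contributes a remainder linear in \<open>t\<close>, which vanishes as \<open>t\<close> tends
      to 0 from the right.\<close>
    have quot: "r + (a - w) \<bullet> (v - w) / \<tau> \<le> p + t * ((norm (v - w))\<^sup>2 / (2 * \<tau>))" if t: "0 < t" "t < 1" for t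
    proof -
      have "(1 - t) *\<^sub>R w + t *\<^sub>R v = w + t *\<^sub>R (v - w)" by (simp add: algebra_simps)
      then have le: "\<phi> (w + t *\<^sub>R (v - w)) \<le> ereal ((1 - t) * r + t * p)"
        using convex_fun_real_bound[OF cvx, of w r v p "1 - t" t] t r real by simp
      then have "\<phi> (w + t *\<^sub>R (v - w)) < \<infinity>" by (cases "\<phi> (w + t *\<^sub>R (v - w))") auto
      then obtain p' where p': "\<phi> (w + t *\<^sub>R (v - w)) = ereal p'" using proper_fun_real[OF pr] by blast
      have "t * (r + (a - w) \<bullet> (v - w) / \<tau>) \<le> t * (p + t * ((norm (v - w))\<^sup>2 / (2 * \<tau>)))"
        using glob[OF p'] le p' unfolding q_step by (simp add: algebra_simps power2_eq_square)
      then show ?thesis using t by simp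
    qed
    have "r + (a - w) \<bullet> (v - w) / \<tau> \<le> p + 0 * ((norm (v - w))\<^sup>2 / (2 * \<tau>))"
    proof (rule tendsto_lowerbound)
      show "((\<lambda>t. p + t * ((norm (v - w))\<^sup>2 / (2 * \<tau>))) \<longlongrightarrow> p + 0 * ((norm (v - w))\<^sup>2 / (2 * \<tau>))) (at_right 0)"
        by (intro tendsto_intros)
      show "\<forall>\<^sub>F t in at_right 0. r + (a - w) \<bullet> (v - w) / \<tau> \<le> p + t * ((norm (v - w))\<^sup>2 / (2 * \<tau>))"
        unfolding eventually_at_right_field using quot by (intro exI[of _ 1]) auto
    qed simp
    then show ?thesis using real by simp
  qed (use pr in \<open>auto simp: proper_fun_def\<close>)
  then show thesis using r that by blast
qed

text \<open>This law of cosines turns the subgradient inequality at a proximal point into quadratic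
  growth around it.\<close>

lemma prox_three_point_identity:
  fixes w a v :: "'a::real_inner"
  assumes "0 < \<tau>"
  shows "(a - w) \<bullet> (v - w) / \<tau> + (norm (v - a))\<^sup>2 / (2 * \<tau>) =
    (norm (w - a))\<^sup>2 / (2 * \<tau>) + (norm (v - w))\<^sup>2 / (2 * \<tau>)"
proof -
  have "2 * ((a - w) \<bullet> (v - w)) + (norm (v - a))\<^sup>2 = (norm (w - a))\<^sup>2 + (norm (v - w))\<^sup>2"
    unfolding power2_norm_eq_inner by (simp add: inner_diff_left inner_diff_right inner_commute)
  then show ?thesis using assms by (simp add: field_simps)
qed

text \<open>The objective in \<open>prox\<close> is \<open>\<tau>\<close> times the one in
  \<open>moreau_env\<close>, so one point minimizes both. Quadratic growth around it gives the
  uniqueness that the \<open>THE\<close> in \<open>prox\<close> relies on.\<close>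

lemma moreau_env_eq_prox:
  fixes g :: "'a::euclidean_space \<Rightarrow> ereal"
  assumes pr: "proper_fun g" and lsc: "lsc_fun g" and cvx: "convex_fun g" and lam: "0 < \<tau>"
  shows "\<exists>r. g (prox (\<lambda>w. ereal \<tau> * g w) a) = ereal r \<and>
    moreau_env \<tau> g a = ereal (r + 1 / (2 * \<tau>) * (norm (prox (\<lambda>w. ereal \<tau> * g w) a - a))\<^sup>2)"
proof -
  obtain w r where r: "g w = ereal r" and sub: "\<And>v. ereal (r + (a - w) \<bullet> (v - w) / \<tau>) \<le> g v"
    using prox_exists_subgradient[OF pr lsc cvx lam, of a] by blast
  have growth: "r + (norm (w - a))\<^sup>2 / (2 * \<tau>) + (norm (v - w))\<^sup>2 / (2 * \<tau>) \<le> p + (norm (v - a))\<^sup>2 / (2 * \<tau>)"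
    if "g v = ereal p" for v p
    using sub[of v] that prox_three_point_identity[OF lam, of a w v] by simp
  let ?h = "\<lambda>w. ereal \<tau> * g w + ereal (1 / 2 * (norm (w - a))\<^sup>2)"
  have hle: "?h w + ereal ((norm (v - w))\<^sup>2 / 2) \<le> ?h v" for v
  proof (cases "g v")
    case (real p)
    have "\<tau> * (r + (norm (w - a))\<^sup>2 / (2 * \<tau>) + (norm (v - w))\<^sup>2 / (2 * \<tau>)) \<le> \<tau> * (p + (norm (v - a))\<^sup>2 / (2 * \<tau>))"
      using growth[OF real] lam by (intro mult_left_mono) auto
    then show ?thesis using real r lam by (simp add: algebra_simps)
  qed (use pr lam in \<open>auto simp: proper_fun_def\<close>)
  have "prox (\<lambda>w. ereal \<tau> * g w) a = w"
    unfolding prox_def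
  proof (rule the_equality)
    have "?h w \<le> ?h v" for v
      by (rule order_trans[OF _ hle[of v]]) (simp add: r)
    then show "is_minimizer ?h w" unfolding is_minimizer_def effdom_def using r by auto
  next
    fix v assume "is_minimizer ?h v"
    then have "?h v \<le> ?h w" unfolding is_minimizer_def by blast
    then have "?h w + ereal ((norm (v - w))\<^sup>2 / 2) \<le> ?h w" using hle[of v] by simp
    then show "v = w" using r by simp
  qed
  moreover have "moreau_env \<tau> g a = ereal (r + 1 / (2 * \<tau>) * (norm (w - a))\<^sup>2)"
    unfolding moreau_env_def
  proof (rule antisym)
    show "(INF w. g w + ereal (1 / (2 * \<tau>) * (norm (w - a))\<^sup>2)) \<le> ereal (r + 1 / (2 * \<tau>) * (norm (w - a))\<^sup>2)"
      by (rule INF_lower2[of w]) (auto simp: r)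
    show "ereal (r + 1 / (2 * \<tau>) * (norm (w - a))\<^sup>2) \<le> (INF w. g w + ereal (1 / (2 * \<tau>) * (norm (w - a))\<^sup>2))"
    proof (rule INF_greatest)
      fix v
      show "ereal (r + 1 / (2 * \<tau>) * (norm (w - a))\<^sup>2) \<le> g v + ereal (1 / (2 * \<tau>) * (norm (v - a))\<^sup>2)"
      proof (cases "g v")
        case (real p)
        have "0 \<le> (norm (v - w))\<^sup>2 / (2 * \<tau>)" using lam by simp
        then show ?thesis using growth[OF real] real by simp
      qed (use pr in \<open>auto simp: proper_fun_def\<close>)
    qed
  qed
  ultimately show ?thesis using r by simp
qed

section \<open>Dual function and value function\<close>

text \<open>Unfolding the conjugate shows \<open>-d\<close> as a supremum of functions affine in
  \<open>y\<close>, indexed by \<open>x\<close> and a point \<open>w\<close> of the domain of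
  \<open>g\<close>. Here each of them is a minorant; \<open>uminus_dual_fun_le\<close> says that
  \<open>-d\<close> is their least upper bound. Later arguments use only these two facts about
  \<open>d\<close>.\<close>

lemma uminus_dual_fun_ge:
  assumes "g w = ereal p"
  shows "ereal (y \<bullet> (w - c x) - f x - p) \<le> - dual_fun f g c y"
proof -
  have "dual_fun f g c y \<le> lagrangian f g c x y"
    unfolding dual_fun_def by (rule INF_lower) simp
  moreover have "ereal (y \<bullet> w - p) \<le> conjugate g y"
    unfolding conjugate_def by (rule SUP_upper2[of w]) (auto simp: assms)
  ultimately have "dual_fun f g c y \<le> ereal (f x + y \<bullet> c x - (y \<bullet> w - p))"
    unfolding lagrangian_def by (cases "conjugate g y"; cases "dual_fun f g c y") auto
  then show ?thesis
    by (cases "dual_fun f g c y") (auto simp: inner_diff_right)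
qed

lemma uminus_dual_fun_le:
  assumes pr: "proper_fun g"
    and le: "\<And>x w p. g w = ereal p \<Longrightarrow> y \<bullet> (w - c x) - f x - p \<le> M"
  shows "- dual_fun f g c y \<le> ereal M"
proof -
  have "ereal (- M) \<le> lagrangian f g c x y" for x
  proof -
    have "conjugate g y \<le> ereal (f x + y \<bullet> c x + M)"
      unfolding conjugate_def
    proof (rule SUP_least)
      fix w show "ereal (y \<bullet> w) - g w \<le> ereal (f x + y \<bullet> c x + M)"
        using le[of w _ x] pr by (cases "g w") (auto simp: inner_diff_right proper_fun_def algebra_simps)
    qed
    then show ?thesis unfolding lagrangian_def by (cases "conjugate g y") auto
  qed
  then have "ereal (- M) \<le> dual_fun f g c y"
    unfolding dual_fun_def by (intro INF_greatest) auto
  then show ?thesis by (cases "dual_fun f g c y") auto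
qed

lemma uminus_dual_fun_not_MInf:
  assumes "proper_fun g"
  shows "- dual_fun f g c y \<noteq> -\<infinity>"
proof -
  obtain w where "g w < \<infinity>" using assms unfolding proper_fun_def effdom_def by auto
  then obtain p where "g w = ereal p" using proper_fun_real[OF assms] by blast
  \<comment> \<open>Any point of the primal space would do; \<open>undefined\<close> stands for an
    arbitrary one.\<close>
  then have "ereal (y \<bullet> (w - c undefined) - f undefined - p) \<le> - dual_fun f g c y"
    by (rule uminus_dual_fun_ge)
  then show ?thesis by auto
qed

lemma convex_fun_uminus_dual_fun:
  assumes pr: "proper_fun g"
  shows "convex_fun (\<lambda>y. - dual_fun f g c y)"
proof (rule convex_funI)
  show "- dual_fun f g c y \<noteq> -\<infinity>" for y by (rule uminus_dual_fun_not_MInf[OF pr])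
next
  fix y y' a a' and u v :: real
  assume a: "- dual_fun f g c y = ereal a" "- dual_fun f g c y' = ereal a'"
    and uv: "0 < u" "0 < v" "u + v = 1"
  show "- dual_fun f g c (u *\<^sub>R y + v *\<^sub>R y') \<le> ereal (u * a + v * a')"
  proof (rule uminus_dual_fun_le[OF pr])
    fix x w p assume gw: "g w = ereal p"
    have "y \<bullet> (w - c x) - f x - p \<le> a" "y' \<bullet> (w - c x) - f x - p \<le> a'"
      using uminus_dual_fun_ge[where g = g and w = w and c = c and f = f and x = x, OF gw, of y]
        uminus_dual_fun_ge[where g = g and w = w and c = c and f = f and x = x, OF gw, of y'] a by auto
    then have "u * (y \<bullet> (w - c x) - f x - p) + v * (y' \<bullet> (w - c x) - f x - p) \<le> u * a + v * a'"
      using uv by (intro add_mono mult_left_mono) auto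
    moreover have "(u *\<^sub>R y + v *\<^sub>R y') \<bullet> (w - c x) - f x - p =
        u * (y \<bullet> (w - c x) - f x - p) + v * (y' \<bullet> (w - c x) - f x - p) - (1 - (u + v)) * (f x + p)"
      by (simp add: inner_add_left algebra_simps)
    ultimately show "(u *\<^sub>R y + v *\<^sub>R y') \<bullet> (w - c x) - f x - p \<le> u * a + v * a'"
      using uv by simp
  qed
qed

section \<open>Distance to a convex set and the penalized dual objective\<close>

lemma infdist_eq_norm_closest_point:
  fixes S :: "'a::euclidean_space set"
  assumes "closed S" "S \<noteq> {}"
  shows "infdist y S = norm (y - closest_point S y)"
  using setdist_closest_point[OF assms, of y] by (simp add: infdist_eq_setdist dist_norm)

text \<open>The same convex combination of the two projections lies in \<open>S\<close>, so the
  distance is convex. Squaring produces the remainder \<open>u * v\<close> times the squared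
  difference of the distances, which enters with a minus sign and is dropped.\<close>

lemma infdist_square_convex:
  fixes S :: "'a::euclidean_space set"
  assumes S: "closed S" "convex S" "S \<noteq> {}" and uv: "0 \<le> u" "0 \<le> v" "u + v = 1"
  shows "(infdist (u *\<^sub>R y + v *\<^sub>R y') S)\<^sup>2 \<le> u * (infdist y S)\<^sup>2 + v * (infdist y' S)\<^sup>2"
proof -
  let ?P = "closest_point S"
  have "u *\<^sub>R ?P y + v *\<^sub>R ?P y' \<in> S"
    using S uv closest_point_in_set by (intro convexD) auto
  then have "infdist (u *\<^sub>R y + v *\<^sub>R y') S \<le> norm (u *\<^sub>R y + v *\<^sub>R y' - (u *\<^sub>R ?P y + v *\<^sub>R ?P y'))"
    using infdist_le by (metis dist_norm)
  also have "\<dots> = norm (u *\<^sub>R (y - ?P y) + v *\<^sub>R (y' - ?P y'))"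
    by (simp add: algebra_simps)
  also have "\<dots> \<le> u * infdist y S + v * infdist y' S"
    using norm_triangle_ineq[of "u *\<^sub>R (y - ?P y)" "v *\<^sub>R (y' - ?P y')"] uv
      infdist_eq_norm_closest_point[OF S(1,3)] by simp
  finally have "(infdist (u *\<^sub>R y + v *\<^sub>R y') S)\<^sup>2 \<le> (u * infdist y S + v * infdist y' S)\<^sup>2"
    by (rule power_mono) (rule infdist_nonneg)
  also have "\<dots> = u * (infdist y S)\<^sup>2 + v * (infdist y' S)\<^sup>2 - u * v * (infdist y S - infdist y' S)\<^sup>2"
  proof -
    have v: "v = 1 - u" using uv by simp
    show ?thesis unfolding v by (simp add: power2_eq_square algebra_simps)
  qed
  also have "\<dots> \<le> u * (infdist y S)\<^sup>2 + v * (infdist y' S)\<^sup>2" using uv by simp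
  finally show ?thesis .
qed

lemma convex_fun_penalized_dual_obj:
  fixes S :: "'a::euclidean_space set"
  assumes pr: "proper_fun g" and S: "closed S" "convex S" "S \<noteq> {}" and m: "0 \<le> m"
  shows "convex_fun (penalized_dual_obj f g c S m)"
  unfolding convex_fun_def penalized_dual_obj_def
proof (intro allI impI)
  fix y y' and u v :: real
  assume uv: "0 \<le> u" "0 \<le> v" "u + v = 1"
  let ?D = "\<lambda>y. - dual_fun f g c y" and ?q = "\<lambda>y. m / 2 * (infdist y S)\<^sup>2"
  have nMInf: "?D y \<noteq> -\<infinity>" "?D y' \<noteq> -\<infinity>" using uminus_dual_fun_not_MInf[OF pr] by blast+
  have "m / 2 * (infdist (u *\<^sub>R y + v *\<^sub>R y') S)\<^sup>2 \<le> m / 2 * (u * (infdist y S)\<^sup>2 + v * (infdist y' S)\<^sup>2)"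
    using infdist_square_convex[OF S uv] m by (intro mult_left_mono) auto
  then have "?q (u *\<^sub>R y + v *\<^sub>R y') \<le> u * ?q y + v * ?q y'" by (simp add: algebra_simps)
  moreover have "?D (u *\<^sub>R y + v *\<^sub>R y') \<le> ereal u * ?D y + ereal v * ?D y'"
    using convex_fun_uminus_dual_fun[OF pr, of f c] uv unfolding convex_fun_def by blast
  ultimately have "?D (u *\<^sub>R y + v *\<^sub>R y') + ereal (?q (u *\<^sub>R y + v *\<^sub>R y'))
      \<le> (ereal u * ?D y + ereal v * ?D y') + ereal (u * ?q y + v * ?q y')"
    by (intro add_mono) auto
  also have "\<dots> = ereal u * (?D y + ereal (?q y)) + ereal v * (?D y' + ereal (?q y'))"
    using nMInf uv by (cases "?D y"; cases "?D y'") (auto simp: algebra_simps)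
  finally show "?D (u *\<^sub>R y + v *\<^sub>R y') + ereal (?q (u *\<^sub>R y + v *\<^sub>R y'))
      \<le> ereal u * (?D y + ereal (?q y)) + ereal v * (?D y' + ereal (?q y'))" .
qed

section \<open>The value function and one step of the method\<close>

lemma value_fun_le:
  assumes "g (c x - u) \<le> ereal p"
  shows "value_fun f g c u \<le> ereal (f x + p)"
  unfolding value_fun_def
  using assms by (intro INF_lower2[of x]) (auto simp: add_left_mono simp flip: plus_ereal.simps(1))

lemma value_fun_lessE:
  assumes "value_fun f g c u < ereal r" and pr: "proper_fun g"
  obtains x p where "g (c x - u) = ereal p" "f x + p < r"
proof -
  obtain x where x: "ereal (f x) + g (c x - u) < ereal r"
    using assms unfolding value_fun_def INF_less_iff by blast
  then have "g (c x - u) < \<infinity>" by (cases "g (c x - u)") auto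
  then obtain p where "g (c x - u) = ereal p" using proper_fun_real[OF pr] by blast
  then show thesis using x that by simp
qed

text \<open>For points \<open>x\<close>, \<open>x'\<close> optimal up to \<open>e\<close>, convexity
  of \<open>g\<close> handles the combination \<open>?w\<close> of \<open>c x - u\<close> and
  \<open>c x' - u'\<close>. The argument actually needed differs from \<open>?w\<close> by a horizon
  direction of \<open>g\<close>, and such a shift does not increase \<open>g\<close>.\<close>

lemma convex_fun_value_fun:
  assumes f: "convex_on UNIV f" and g: "proper_fun g" "convex_fun g"
    and c: "neg_cone_convex (hzn g) c" and V: "proper_fun (value_fun f g c)"
  shows "convex_fun (value_fun f g c)"
proof (rule convex_funI)
  show "value_fun f g c u \<noteq> -\<infinity>" for u using V unfolding proper_fun_def by blast
next
  fix u u' a a' and s t :: real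
  let ?V = "value_fun f g c"
  assume a: "?V u = ereal a" "?V u' = ereal a'" and st: "0 < s" "0 < t" "s + t = 1"
  show "?V (s *\<^sub>R u + t *\<^sub>R u') \<le> ereal (s * a + t * a')"
  proof (rule ereal_le_epsilon2)
    fix e :: real assume e: "0 < e"
    obtain x p where x: "g (c x - u) = ereal p" "f x + p < a + e"
      using value_fun_lessE[of f g c u "a + e"] a e g by auto
    obtain x' p' where x': "g (c x' - u') = ereal p'" "f x' + p' < a' + e"
      using value_fun_lessE[of f g c u' "a' + e"] a e g by auto
    let ?x = "s *\<^sub>R x + t *\<^sub>R x'" and ?w = "s *\<^sub>R (c x - u) + t *\<^sub>R (c x' - u')"
    have gw: "g ?w \<le> ereal (s * p + t * p')"
      using convex_fun_real_bound[OF g(2), of "c x - u" p "c x' - u'" p' s t] x x' st by simp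
    then have "?w \<in> effdom g" unfolding effdom_def by (cases "g ?w") auto
    moreover have "c ?x - s *\<^sub>R c x - t *\<^sub>R c x' \<in> hzn g"
    proof -
      have t: "t = 1 - s" "s \<in> {0..1}" using st by auto
      show ?thesis using c t(2) unfolding neg_cone_convex_def t(1) by blast
    qed
    ultimately have "g (?w + (c ?x - s *\<^sub>R c x - t *\<^sub>R c x')) \<le> g ?w"
      unfolding hzn_def by blast
    moreover have "?w + (c ?x - s *\<^sub>R c x - t *\<^sub>R c x') = c ?x - (s *\<^sub>R u + t *\<^sub>R u')"
      by (simp add: algebra_simps)
    ultimately have "g (c ?x - (s *\<^sub>R u + t *\<^sub>R u')) \<le> ereal (s * p + t * p')"
      using gw by simp
    then have "?V (s *\<^sub>R u + t *\<^sub>R u') \<le> ereal (f ?x + (s * p + t * p'))"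
      by (rule value_fun_le)
    also have "f ?x + (s * p + t * p') \<le> s * (f x + p) + t * (f x' + p')"
    proof -
      have s: "s = 1 - t" using st by simp
      have "f ((1 - t) *\<^sub>R x + t *\<^sub>R x') \<le> (1 - t) * f x + t * f x'"
        using convex_onD[OF f, of t x x'] st by simp
      then show ?thesis unfolding s by (simp add: algebra_simps)
    qed
    also have "\<dots> \<le> s * (a + e) + t * (a' + e)"
      by (rule add_mono; rule mult_left_mono) (use x x' st in auto)
    also have "\<dots> = (s * a + t * a') + (s + t) * e" by (simp add: algebra_simps)
    finally show "?V (s *\<^sub>R u + t *\<^sub>R u') \<le> ereal (s * a + t * a') + ereal e" using st by simp
  qed
qed

text \<open>This is weak duality: points that are nearly optimal for the value at \<open>u\<close>
  yield minorants of \<open>-d\<close> arbitrarily close to the claimed one.\<close>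

lemma uminus_dual_fun_ge_value_fun:
  assumes pr: "proper_fun g" and r: "value_fun f g c u = ereal r"
  shows "ereal (- (y \<bullet> u) - r) \<le> - dual_fun f g c y"
proof (rule ereal_le_epsilon2)
  fix e :: real assume "0 < e"
  then obtain x p where x: "g (c x - u) = ereal p" "f x + p < r + e"
    using value_fun_lessE[of f g c u "r + e"] r pr by auto
  have "ereal (- (y \<bullet> u) - f x - p) \<le> - dual_fun f g c y"
    using uminus_dual_fun_ge[where g = g and w = "c x - u" and c = c and f = f and x = x, OF x(1), of y] by simp
  moreover have "- (y \<bullet> u) - r - e \<le> - (y \<bullet> u) - f x - p" using x by simp
  ultimately show "ereal (- (y \<bullet> u) - r) \<le> - dual_fun f g c y + ereal e"
    by (cases "dual_fun f g c y") auto
qed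

text \<open>Writing \<open>u = c x - z\<close>, the inner problem amounts to minimizing the value
  function plus a quadratic centred at \<open>- (m *\<^sub>R yh)\<close>. Its exact minimizer
  \<open>w\<close> gives the exact multiplier \<open>ybar\<close>, and quadratic growth around
  \<open>w\<close> controls how far the inexact \<open>u\<close> can be from
  \<open>w\<close>.\<close>

lemma alm_step:
  fixes g :: "'b::euclidean_space \<Rightarrow> ereal"
  assumes f: "convex_on UNIV f" and g: "proper_fun g" "lsc_fun g" "convex_fun g"
    and c: "neg_cone_convex (hzn g) c"
    and V: "proper_fun (value_fun f g c)" "lsc_fun (value_fun f g c)"
    and m: "0 < m" and e: "0 \<le> e"
    and opt: "aug_lagrangian f g c m x yh \<le> (INF x'. aug_lagrangian f g c m x' yh) + ereal e"
    and z: "z = prox (\<lambda>w. ereal m * g w) (c x + m *\<^sub>R yh)"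
  obtains ybar d where "- dual_fun f g c ybar = ereal d"
    "\<And>v. ereal (d + m * ((v - ybar) \<bullet> (yh - ybar))) \<le> - dual_fun f g c v"
    "norm (yh + (1 / m) *\<^sub>R (c x - z) - ybar) \<le> sqrt 2 * sqrt (e / m)"
proof -
  let ?V = "value_fun f g c" and ?D = "\<lambda>y. - dual_fun f g c y"
  obtain w r where r: "?V w = ereal r"
    and sub: "\<And>v. ereal (r + (- (m *\<^sub>R yh) - w) \<bullet> (v - w) / m) \<le> ?V v"
    using prox_exists_subgradient[OF V(1,2) convex_fun_value_fun[OF f g(1,3) c V(1)] m, of "- (m *\<^sub>R yh)"]
    by blast
  \<comment> \<open>This is the multiplier update with \<open>w\<close> in the place of
    \<open>c x - z\<close>.\<close>
  define ybar where "ybar = yh + (1 / m) *\<^sub>R w"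
  have w: "w = m *\<^sub>R (ybar - yh)" using m by (simp add: ybar_def)
  have "- (m *\<^sub>R yh) - w = - m *\<^sub>R ybar" unfolding w by (simp add: algebra_simps)
  then have "(- (m *\<^sub>R yh) - w) \<bullet> (v - w) / m = - (ybar \<bullet> (v - w))" for v
    using m by simp
  \<comment> \<open>In other words, \<open>- ybar\<close> is a subgradient of the value function at
    \<open>w\<close>.\<close>
  then have sub: "ereal (r - ybar \<bullet> (v - w)) \<le> ?V v" for v using sub[of v] by simp
  have primal: "r - ybar \<bullet> (c x' - w' - w) \<le> f x' + p" if "g w' = ereal p" for x' w' p
    using order_trans[OF sub[of "c x' - w'"] value_fun_le[of g c x' "c x' - w'" p f]] that by simp
  have lower: "ereal (- (v \<bullet> w) - r) \<le> ?D v" for v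
    using uminus_dual_fun_ge_value_fun[OF g(1) r] .
  \<comment> \<open>Together with \<open>lower\<close> this is the Fenchel equality at
    \<open>w\<close> and \<open>ybar\<close>: the affine minorant
    \<open>- (v \<bullet> w) - r\<close> touches \<open>-d\<close> at \<open>ybar\<close>. Its slope
    \<open>- w = m *\<^sub>R (yh - ybar)\<close> is the subgradient sought.\<close>
  have "?D ybar \<le> ereal (- (ybar \<bullet> w) - r)"
  proof (rule uminus_dual_fun_le[OF g(1)])
    fix x' w' p assume "g w' = ereal p"
    from primal[OF this, of x'] show "ybar \<bullet> (w' - c x') - f x' - p \<le> - (ybar \<bullet> w) - r"
      by (simp add: inner_diff_right)
  qed
  then have D: "?D ybar = ereal (- (ybar \<bullet> w) - r)" using lower by (intro antisym)
  have Dsub: "ereal ((- (ybar \<bullet> w) - r) + m * ((v - ybar) \<bullet> (yh - ybar))) \<le> ?D v" for v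
  proof -
    have "(- (ybar \<bullet> w) - r) + m * ((v - ybar) \<bullet> (yh - ybar)) = - (v \<bullet> w) - r"
      unfolding w by (simp add: inner_diff_left inner_diff_right algebra_simps)
    then show ?thesis using lower[of v] by (simp only:)
  qed
  obtain G where G: "g z = ereal G"
    and env: "moreau_env m g (c x + m *\<^sub>R yh) = ereal (G + 1 / (2 * m) * (norm (z - (c x + m *\<^sub>R yh)))\<^sup>2)"
    using moreau_env_eq_prox[OF g m, of "c x + m *\<^sub>R yh"] unfolding z by blast
  define u where "u = c x - z"
  \<comment> \<open>The slack \<open>\<eta>\<close> is there because the infimum defining the value
    at \<open>w\<close> need not be attained. For a nearly optimal \<open>x'\<close>, the trial
    point \<open>c x' - w\<close> in the Moreau envelope produces the quadratic at \<open>w\<close>,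
    and the term in \<open>norm yh\<close> cancels on both sides.\<close>
  have "f x + G + (norm (u + m *\<^sub>R yh))\<^sup>2 / (2 * m) \<le> r + (norm (w + m *\<^sub>R yh))\<^sup>2 / (2 * m) + e + \<eta>"
    if eta: "0 < \<eta>" for \<eta>
  proof -
    obtain x' p where x': "g (c x' - w) = ereal p" "f x' + p < r + \<eta>"
      using value_fun_lessE[of f g c w "r + \<eta>"] r g(1) eta by auto
    have "c x' - w - (c x' + m *\<^sub>R yh) = - (w + m *\<^sub>R yh)" by simp
    then have "norm (c x' - w - (c x' + m *\<^sub>R yh)) = norm (w + m *\<^sub>R yh)" by (simp only: norm_minus_cancel)
    then have "moreau_env m g (c x' + m *\<^sub>R yh) \<le> ereal (p + (norm (w + m *\<^sub>R yh))\<^sup>2 / (2 * m))"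
      unfolding moreau_env_def by (intro INF_lower2[of "c x' - w"]) (auto simp: x')
    then have "aug_lagrangian f g c m x' yh \<le>
        ereal (f x' + (p + (norm (w + m *\<^sub>R yh))\<^sup>2 / (2 * m)) - m / 2 * (norm yh)\<^sup>2)"
      unfolding aug_lagrangian_def by (cases "moreau_env m g (c x' + m *\<^sub>R yh)") auto
    then have "(INF x'. aug_lagrangian f g c m x' yh) \<le>
        ereal (f x' + (p + (norm (w + m *\<^sub>R yh))\<^sup>2 / (2 * m)) - m / 2 * (norm yh)\<^sup>2)"
      by (intro INF_lower2[of x']) auto
    then have "aug_lagrangian f g c m x yh \<le>
        ereal (f x' + (p + (norm (w + m *\<^sub>R yh))\<^sup>2 / (2 * m)) - m / 2 * (norm yh)\<^sup>2) + ereal e"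
      by (intro order_trans[OF opt] add_right_mono)
    moreover have "norm (z - (c x + m *\<^sub>R yh)) = norm (u + m *\<^sub>R yh)"
      unfolding u_def by (subst norm_minus_commute) (simp add: algebra_simps)
    ultimately show ?thesis using env x'(2) unfolding aug_lagrangian_def by simp
  qed
  then have upper: "f x + G + (norm (u + m *\<^sub>R yh))\<^sup>2 / (2 * m) \<le> r + (norm (w + m *\<^sub>R yh))\<^sup>2 / (2 * m) + e"
    by (rule field_le_epsilon)
  \<comment> \<open>The subgradient inequality bounds the objective at \<open>u\<close> from below.
    Expanding the square around \<open>m *\<^sub>R ybar\<close> cancels the linear term and leaves
    the squared distance of \<open>u\<close> and \<open>w\<close>, which is therefore bounded
    through \<open>e\<close>.\<close>
  have "r - ybar \<bullet> (u - w) \<le> f x + G" using primal[OF G, of x] by (simp add: u_def)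
  moreover have "(norm (u + m *\<^sub>R yh))\<^sup>2 / (2 * m) =
      (norm (w + m *\<^sub>R yh))\<^sup>2 / (2 * m) + ybar \<bullet> (u - w) + (norm (u - w))\<^sup>2 / (2 * m)"
  proof -
    have "w + m *\<^sub>R yh = m *\<^sub>R ybar" unfolding w by (simp add: algebra_simps)
    moreover have "u + m *\<^sub>R yh = m *\<^sub>R ybar + (u - w)" unfolding w by (simp add: algebra_simps)
    moreover have "(norm (m *\<^sub>R ybar + (u - w)))\<^sup>2 =
        (norm (m *\<^sub>R ybar))\<^sup>2 + 2 * m * (ybar \<bullet> (u - w)) + (norm (u - w))\<^sup>2"
      unfolding power2_norm_eq_inner inner_add_left inner_add_right
      by (simp add: inner_commute[of "u - w" ybar])
    ultimately have "(norm (u + m *\<^sub>R yh))\<^sup>2 =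
        (norm (w + m *\<^sub>R yh))\<^sup>2 + 2 * m * (ybar \<bullet> (u - w)) + (norm (u - w))\<^sup>2"
      by (simp only:)
    then show ?thesis using m by (simp add: add_divide_distrib)
  qed
  ultimately have "(norm (u - w))\<^sup>2 / (2 * m) \<le> e" using upper by linarith
  then have "(norm (u - w) / m)\<^sup>2 \<le> 2 * (e / m)"
    using m by (simp add: field_simps power2_eq_square)
  then have "norm (u - w) / m \<le> sqrt 2 * sqrt (e / m)"
    unfolding real_sqrt_mult[symmetric] by (rule real_le_rsqrt)
  moreover have "yh + (1 / m) *\<^sub>R (c x - z) - ybar = (1 / m) *\<^sub>R (u - w)"
    unfolding ybar_def u_def by (simp add: algebra_simps)
  ultimately have "norm (yh + (1 / m) *\<^sub>R (c x - z) - ybar) \<le> sqrt 2 * sqrt (e / m)"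
    using m by simp
  then show thesis using that D Dsub by blast
qed

section \<open>Inexact proximal gradient iterations with decreasing penalty\<close>

text \<open>Every affine minorant of \<open>-d\<close> passes to the limit, hence so does their
  supremum. This is lower semicontinuity in a form that allows the bounds \<open>M n\<close> to
  vary.\<close>

lemma uminus_dual_fun_le_limit:
  fixes g :: "'b::real_inner \<Rightarrow> ereal"
  assumes pr: "proper_fun g" and s: "s \<longlonglongrightarrow> l" and M: "M \<longlonglongrightarrow> a"
    and le: "\<And>n. - dual_fun f g c (s n) \<le> ereal (M n)"
  shows "- dual_fun f g c l \<le> ereal a"
proof (rule uminus_dual_fun_le[OF pr])
  fix x w p assume gw: "g w = ereal p"
  have "s n \<bullet> (w - c x) - f x - p \<le> M n" for n
  proof -
    have "ereal (s n \<bullet> (w - c x) - f x - p) \<le> - dual_fun f g c (s n)"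
      using gw by (rule uminus_dual_fun_ge)
    then show ?thesis using order_trans[OF _ le[of n]] by fastforce
  qed
  moreover have "(\<lambda>n. s n \<bullet> (w - c x) - f x - p) \<longlonglongrightarrow> l \<bullet> (w - c x) - f x - p"
    by (intro tendsto_intros s)
  ultimately show "l \<bullet> (w - c x) - f x - p \<le> a"
    using M by (intro LIMSEQ_le) auto
qed

section \<open>Summability from perturbed descent\<close>

lemma summable_of_quasi_telescoping:
  fixes a h t :: "nat \<Rightarrow> real"
  assumes t: "\<And>k. 0 \<le> t k" and a: "\<And>k. 0 \<le> a k" and h: "summable h" "\<And>k. 0 \<le> h k"
    and le: "\<And>k. a (Suc k) + t k \<le> a k + h k"
  shows "summable t"
proof (rule summableI_nonneg_bounded[OF t])
  fix n
  have "a n + (\<Sum>k<n. t k) \<le> a 0 + (\<Sum>k<n. h k)"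
  proof (induction n)
    case (Suc n)
    then show ?case using le[of n] by simp
  qed simp
  also have "(\<Sum>k<n. h k) \<le> suminf h" using h by (intro sum_le_suminf) auto
  finally show "(\<Sum>k<n. t k) \<le> a 0 + suminf h" using a[of n] by linarith
qed

text \<open>Without \<open>t\<close>, the root of \<open>a\<close> grows by at most
  \<open>e k\<close> per step and so stays below \<open>B\<close>. Expanding the square then shows
  an increase of at most a constant times \<open>e k\<close>, and telescoping applies.\<close>

lemma summable_of_sqrt_quasi_descent:
  fixes a e t :: "nat \<Rightarrow> real"
  assumes t: "\<And>k. 0 \<le> t k" and a: "\<And>k. 0 \<le> a k" and e: "summable e" "\<And>k. 0 \<le> e k"
    and le: "\<And>k. a (Suc k) + t k \<le> (sqrt (a k) + e k)\<^sup>2"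
  shows "summable t"
proof -
  define B where "B = sqrt (a 0) + suminf e"
  have sum_le: "(\<Sum>k<n. e k) \<le> suminf e" for n using e by (intro sum_le_suminf) auto
  have "sqrt (a n) \<le> sqrt (a 0) + (\<Sum>k<n. e k)" for n
  proof (induction n)
    case (Suc n)
    have "a (Suc n) \<le> (sqrt (a n) + e n)\<^sup>2" using le[of n] t[of n] by linarith
    then have "sqrt (a (Suc n)) \<le> sqrt (a n) + e n"
      using a[of n] e(2)[of n] by (intro real_le_lsqrt) auto
    then show ?case using Suc by simp
  qed simp
  then have B: "sqrt (a n) \<le> B" for n unfolding B_def using sum_le[of n] by (meson add_left_mono order_trans)
  have eE: "e n \<le> suminf e" for n
    using sum_le[of "Suc n"] sum_nonneg[of "{..<n}" e] e(2) by simp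
  show ?thesis
  proof (rule summable_of_quasi_telescoping[OF t a])
    show "summable (\<lambda>k. (2 * B + suminf e) * e k)" using e by (intro summable_mult)
    have "0 \<le> B" using B[of 0] a[of 0] by (meson order_trans real_sqrt_ge_zero)
    moreover have "0 \<le> suminf e" using e by (intro suminf_nonneg) auto
    ultimately show "0 \<le> (2 * B + suminf e) * e k" for k using e(2)[of k] by simp
    show "a (Suc k) + t k \<le> a k + (2 * B + suminf e) * e k" for k
    proof -
      have "(sqrt (a k) + e k)\<^sup>2 = a k + (2 * sqrt (a k) + e k) * e k"
        using a[of k] by (simp add: power2_eq_square algebra_simps)
      also have "\<dots> \<le> a k + (2 * B + suminf e) * e k"
        using B[of k] eE[of k] e(2)[of k] by (intro add_left_mono mult_right_mono) auto
      finally show ?thesis using le[of k] by linarith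
    qed
  qed
qed

lemma summable_power2_of_nonneg:
  fixes e :: "nat \<Rightarrow> real"
  assumes e: "summable e" "\<And>k. 0 \<le> e k"
  shows "summable (\<lambda>k. (e k)\<^sup>2)"
proof (rule summable_comparison_test')
  show "summable (\<lambda>k. suminf e * e k)" using e by (intro summable_mult)
  show "norm ((e k)\<^sup>2) \<le> suminf e * e k" for k
    using sum_le_suminf[of e "{k}"] e by (simp add: power2_eq_square mult_right_mono)
qed

lemma tendsto_scaleR_of_summable_weighted_squares:
  fixes v :: "nat \<Rightarrow> 'a::real_normed_vector"
  assumes "summable (\<lambda>k. \<mu> k * (norm (v k))\<^sup>2)" and mu: "\<And>k. 0 < \<mu> k" "decseq \<mu>"
  shows "(\<lambda>k. \<mu> k *\<^sub>R v k) \<longlonglongrightarrow> 0"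
proof -
  have "(\<lambda>k. \<mu> 0 * (\<mu> k * (norm (v k))\<^sup>2)) \<longlonglongrightarrow> \<mu> 0 * 0"
    by (intro tendsto_mult tendsto_const summable_LIMSEQ_zero assms(1))
  then have "(\<lambda>k. \<mu> 0 * (\<mu> k * (norm (v k))\<^sup>2)) \<longlonglongrightarrow> 0" by simp
  then have "(\<lambda>k. (norm (\<mu> k *\<^sub>R v k))\<^sup>2) \<longlonglongrightarrow> 0"
  proof (rule Lim_null_comparison[rotated], intro always_eventually allI)
    fix k
    have "\<mu> k \<le> \<mu> 0" using mu(2) by (simp add: decseq_def)
    then have "\<mu> k * (\<mu> k * (norm (v k))\<^sup>2) \<le> \<mu> 0 * (\<mu> k * (norm (v k))\<^sup>2)"
      using mu(1)[of k] by (intro mult_right_mono) auto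
    then show "norm ((norm (\<mu> k *\<^sub>R v k))\<^sup>2) \<le> \<mu> 0 * (\<mu> k * (norm (v k))\<^sup>2)"
      using mu(1)[of k] by (simp add: power2_eq_square mult_ac)
  qed
  then have "(\<lambda>k. norm (\<mu> k *\<^sub>R v k)) \<longlonglongrightarrow> 0" by simp
  then show ?thesis by (rule tendsto_norm_zero_cancel)
qed

section \<open>The inexact iteration: summable differences and accumulation points\<close>

lemma norm_add3_square_le:
  fixes a b c :: "'a::real_normed_vector"
  shows "(norm (a + b + c))\<^sup>2 \<le> 3 * ((norm a)\<^sup>2 + (norm b)\<^sup>2 + (norm c)\<^sup>2)"
proof -
  have "norm (a + b + c) \<le> norm a + norm b + norm c" by norm
  then have "(norm (a + b + c))\<^sup>2 \<le> (norm a + norm b + norm c)\<^sup>2" by (rule power_mono) simp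
  also have "\<dots> = 3 * ((norm a)\<^sup>2 + (norm b)\<^sup>2 + (norm c)\<^sup>2)
      - (norm a - norm b)\<^sup>2 - (norm b - norm c)\<^sup>2 - (norm a - norm c)\<^sup>2"
    by (simp add: power2_eq_square algebra_simps)
  also have "\<dots> \<le> 3 * ((norm a)\<^sup>2 + (norm b)\<^sup>2 + (norm c)\<^sup>2)"
    using zero_le_power2[of "norm a - norm b"] zero_le_power2[of "norm b - norm c"]
      zero_le_power2[of "norm a - norm c"] by linarith
  finally show ?thesis .
qed

text \<open>The vector \<open>y - closest_point S y\<close> is the gradient of half the squared
  distance. The obtuse angle property of the projection provides the sign of the inner
  product.\<close>

lemma infdist_square_subgradient:
  fixes S :: "'a::euclidean_space set"
  assumes S: "closed S" "convex S" "S \<noteq> {}"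
  shows "(infdist y S)\<^sup>2 + 2 * ((v - y) \<bullet> (y - closest_point S y)) \<le> (infdist v S)\<^sup>2"
proof -
  let ?p = "closest_point S y" and ?q = "closest_point S v"
  have "(y - ?p) \<bullet> (?q - ?p) \<le> 0"
    using S by (intro closest_point_dot closest_point_in_set)
  moreover have "(norm (v - ?q))\<^sup>2 = (norm (y - ?p))\<^sup>2 + 2 * ((v - y) \<bullet> (y - ?p))
      + (norm (v - ?q - (y - ?p)))\<^sup>2 - 2 * ((y - ?p) \<bullet> (?q - ?p))"
    unfolding power2_norm_eq_inner by (simp add: inner_diff_left inner_diff_right inner_commute)
  ultimately show ?thesis unfolding infdist_eq_norm_closest_point[OF S(1,3)]
    using zero_le_power2[of "norm (v - ?q - (y - ?p))"] by linarith
qed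

text \<open>Here \<open>Y k\<close> is the exact outcome of stage \<open>k\<close>,
  \<open>y (Suc k)\<close> the computed one, and \<open>d k\<close> stands for the value of
  \<open>-d\<close> at \<open>Y k\<close>. The subgradient inequality is needed only between
  consecutive exact outcomes.\<close>

lemma inexact_prox_gradient_summable:
  fixes Y y :: "nat \<Rightarrow> 'a::euclidean_space"
  assumes S: "closed S" "convex S" "S \<noteq> {}" and mu: "\<And>k. 0 < \<mu> k" "decseq \<mu>"
    and d: "\<And>k. b \<le> d k"
    and sub: "\<And>k. d (Suc k) + \<mu> (Suc k) * ((Y k - Y (Suc k)) \<bullet> (closest_point S (y (Suc k)) - Y (Suc k))) \<le> d k"
    and near: "\<And>k. norm (y (Suc k) - Y k) \<le> \<delta> k" and \<delta>: "summable \<delta>"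
  shows "summable (\<lambda>k. \<mu> k * (norm (y (Suc k) - y k))\<^sup>2)"
proof -
  define a where "a k = d k - b + \<mu> k / 2 * (infdist (Y k) S)\<^sup>2" for k
  have \<delta>0: "0 \<le> \<delta> k" for k using near[of k] norm_ge_zero order_trans by blast
  have a0: "0 \<le> a k" for k using d[of k] mu(1)[of k] by (simp add: a_def)
  have "summable (\<lambda>k. \<mu> (Suc k) / 2 * (norm (Y (Suc k) - Y k))\<^sup>2)"
  proof (rule summable_of_sqrt_quasi_descent[of _ a "\<lambda>k. sqrt (\<mu> 0) * \<delta> k"])
    fix k
    let ?D = "infdist (Y k) S" and ?yh = "closest_point S (y (Suc k))"
    \<comment> \<open>Since the projection is nonexpansive, replacing \<open>Y k\<close> by
      \<open>y (Suc k)\<close> before projecting costs at most \<open>\<delta> k\<close>.\<close>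
    have near_yh: "norm (Y k - ?yh) \<le> ?D + \<delta> k"
    proof -
      have "norm (closest_point S (Y k) - ?yh) \<le> norm (Y k - y (Suc k))"
        using closest_point_lipschitz[of S "Y k" "y (Suc k)"] S by (simp add: dist_norm)
      then show ?thesis
        using norm_triangle_ineq[of "Y k - closest_point S (Y k)" "closest_point S (Y k) - ?yh"] near[of k]
        by (simp add: infdist_eq_norm_closest_point[OF S(1,3)] norm_minus_commute)
    qed
    have "infdist (Y (Suc k)) S \<le> norm (Y (Suc k) - ?yh)"
      using infdist_le[OF closest_point_in_set[OF S(1,3)]] by (metis dist_norm)
    then have far: "(infdist (Y (Suc k)) S)\<^sup>2 \<le> (norm (Y (Suc k) - ?yh))\<^sup>2"
      by (intro power_mono infdist_nonneg)
    have polar: "2 * ((Y k - Y (Suc k)) \<bullet> (?yh - Y (Suc k))) =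
        (norm (Y (Suc k) - Y k))\<^sup>2 + (norm (Y (Suc k) - ?yh))\<^sup>2 - (norm (Y k - ?yh))\<^sup>2"
      unfolding power2_norm_eq_inner by (simp add: inner_diff_left inner_diff_right inner_commute)
    have "(norm (Y k - ?yh))\<^sup>2 \<le> (?D + \<delta> k)\<^sup>2" using near_yh by (intro power_mono) auto
    then have "(norm (Y (Suc k) - Y k))\<^sup>2 + (infdist (Y (Suc k)) S)\<^sup>2 - (?D + \<delta> k)\<^sup>2 \<le>
        2 * ((Y k - Y (Suc k)) \<bullet> (?yh - Y (Suc k)))"
      unfolding polar using far by linarith
    then have "\<mu> (Suc k) / 2 * ((norm (Y (Suc k) - Y k))\<^sup>2 + (infdist (Y (Suc k)) S)\<^sup>2 - (?D + \<delta> k)\<^sup>2) \<le>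
        \<mu> (Suc k) / 2 * (2 * ((Y k - Y (Suc k)) \<bullet> (?yh - Y (Suc k))))"
      using mu(1)[of "Suc k"] by (intro mult_left_mono) auto
    then have "a (Suc k) + \<mu> (Suc k) / 2 * (norm (Y (Suc k) - Y k))\<^sup>2 \<le> d k - b + \<mu> (Suc k) / 2 * (?D + \<delta> k)\<^sup>2"
      using sub[of k] unfolding a_def by (simp add: algebra_simps)
    \<comment> \<open>Monotonicity of the penalty parameters makes the two stages comparable: the
      right-hand side now carries the weight \<open>\<mu> k\<close> that occurs in
      \<open>a k\<close>.\<close>
    also have "\<dots> \<le> d k - b + \<mu> k / 2 * (?D + \<delta> k)\<^sup>2"
      using mu(2) by (intro add_left_mono mult_right_mono) (auto simp: decseq_Suc_iff)
    also have "\<dots> = a k + (sqrt (\<mu> k) * ?D) * (sqrt (\<mu> k) * \<delta> k) + (sqrt (\<mu> k) * \<delta> k)\<^sup>2 / 2"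
    proof -
      have "(sqrt (\<mu> k) * ?D) * (sqrt (\<mu> k) * \<delta> k) = \<mu> k * ?D * \<delta> k"
        "(sqrt (\<mu> k) * \<delta> k)\<^sup>2 = \<mu> k * (\<delta> k)\<^sup>2"
        using mu(1)[of k] by (auto simp: power_mult_distrib less_imp_le)
      then show ?thesis unfolding a_def by (simp only:) (simp add: power2_sum algebra_simps)
    qed
    \<comment> \<open>The penalty part of \<open>a k\<close> bounds
      \<open>sqrt (\<mu> k) * ?D\<close>, and \<open>\<mu> 0\<close> replaces \<open>\<mu> k\<close>
      to give errors with a fixed factor. The sum is then a perfect square.\<close>
    also have "\<dots> \<le> a k + (2 * sqrt (a k)) * (sqrt (\<mu> 0) * \<delta> k) + (sqrt (\<mu> 0) * \<delta> k)\<^sup>2"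
    proof -
      have "(sqrt (\<mu> k) * ?D)\<^sup>2 \<le> (2 * sqrt (a k))\<^sup>2"
        using mu(1)[of k] d[of k] a0[of k] by (simp add: power_mult_distrib a_def)
      then have 1: "sqrt (\<mu> k) * ?D \<le> 2 * sqrt (a k)" by (rule power2_le_imp_le) (use a0 in simp)
      have "\<mu> k \<le> \<mu> 0" using mu(2) by (simp add: decseq_def)
      then have 2: "sqrt (\<mu> k) * \<delta> k \<le> sqrt (\<mu> 0) * \<delta> k" using \<delta>0 by (intro mult_right_mono) auto
      have 3: "0 \<le> sqrt (\<mu> k) * \<delta> k" using \<delta>0 mu(1)[of k] by simp
      have "(sqrt (\<mu> k) * ?D) * (sqrt (\<mu> k) * \<delta> k) \<le> (2 * sqrt (a k)) * (sqrt (\<mu> 0) * \<delta> k)"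
        by (rule mult_mono[OF 1 2 _ 3]) (use a0[of k] in simp)
      moreover have "(sqrt (\<mu> k) * \<delta> k)\<^sup>2 \<le> (sqrt (\<mu> 0) * \<delta> k)\<^sup>2" using 2 3 by (rule power_mono)
      ultimately show ?thesis using zero_le_power2[of "sqrt (\<mu> k) * \<delta> k"] by linarith
    qed
    also have "\<dots> = (sqrt (a k) + sqrt (\<mu> 0) * \<delta> k)\<^sup>2"
      using a0[of k] by (simp add: power2_sum)
    finally show "a (Suc k) + \<mu> (Suc k) / 2 * (norm (Y (Suc k) - Y k))\<^sup>2 \<le> (sqrt (a k) + sqrt (\<mu> 0) * \<delta> k)\<^sup>2" .
  qed (use mu(1) \<delta> \<delta>0 a0 in \<open>auto intro!: summable_mult mult_nonneg_nonneg simp: less_imp_le\<close>)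
  then have "summable (\<lambda>k. 2 * (\<mu> (Suc k) / 2 * (norm (Y (Suc k) - Y k))\<^sup>2))" by (rule summable_mult)
  then have Y: "summable (\<lambda>k. \<mu> (Suc k) * (norm (Y (Suc k) - Y k))\<^sup>2)" by simp
  have \<delta>2: "summable (\<lambda>k. (\<delta> k)\<^sup>2)" using \<delta> \<delta>0 by (rule summable_power2_of_nonneg)
  \<comment> \<open>The starting point \<open>y 0\<close> is not close to any exact outcome, so the
    comparison of \<open>y\<close> with \<open>Y\<close> begins at \<open>y 1\<close>; the omitted
    first term does not affect summability.\<close>
  have "summable (\<lambda>k. \<mu> (Suc k) * (norm (y (Suc (Suc k)) - y (Suc k)))\<^sup>2)"
  proof (rule summable_comparison_test')
    show "summable (\<lambda>k. 3 * (\<mu> (Suc k) * (norm (Y (Suc k) - Y k))\<^sup>2 + \<mu> 0 * (\<delta> (Suc k))\<^sup>2 + \<mu> 0 * (\<delta> k)\<^sup>2))"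
      using \<delta>2 by (intro summable_mult summable_add Y) (auto simp: summable_Suc_iff[of "\<lambda>k. (\<delta> k)\<^sup>2"])
    fix k
    have mu_le: "\<mu> (Suc k) \<le> \<mu> 0" using mu(2) unfolding decseq_def by blast
    have "y (Suc (Suc k)) - y (Suc k) = (Y (Suc k) - Y k) + (y (Suc (Suc k)) - Y (Suc k)) + (Y k - y (Suc k))"
      by simp
    then have "(norm (y (Suc (Suc k)) - y (Suc k)))\<^sup>2 \<le> 3 * ((norm (Y (Suc k) - Y k))\<^sup>2 +
        (norm (y (Suc (Suc k)) - Y (Suc k)))\<^sup>2 + (norm (Y k - y (Suc k)))\<^sup>2)"
      using norm_add3_square_le[of "Y (Suc k) - Y k" "y (Suc (Suc k)) - Y (Suc k)" "Y k - y (Suc k)"]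
      by (simp only:)
    also have "\<dots> \<le> 3 * ((norm (Y (Suc k) - Y k))\<^sup>2 + (\<delta> (Suc k))\<^sup>2 + (\<delta> k)\<^sup>2)"
      using near[of k] near[of "Suc k"] by (intro mult_left_mono add_mono power_mono) (auto simp: norm_minus_commute)
    finally have "\<mu> (Suc k) * (norm (y (Suc (Suc k)) - y (Suc k)))\<^sup>2 \<le>
        \<mu> (Suc k) * (3 * ((norm (Y (Suc k) - Y k))\<^sup>2 + (\<delta> (Suc k))\<^sup>2 + (\<delta> k)\<^sup>2))"
      using mu(1)[of "Suc k"] by (intro mult_left_mono) auto
    also have "\<dots> = 3 * (\<mu> (Suc k) * (norm (Y (Suc k) - Y k))\<^sup>2 + \<mu> (Suc k) * (\<delta> (Suc k))\<^sup>2 + \<mu> (Suc k) * (\<delta> k)\<^sup>2)"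
      by (simp add: algebra_simps)
    also have "\<dots> \<le> 3 * (\<mu> (Suc k) * (norm (Y (Suc k) - Y k))\<^sup>2 + \<mu> 0 * (\<delta> (Suc k))\<^sup>2 + \<mu> 0 * (\<delta> k)\<^sup>2)"
      using mu_le by (intro mult_left_mono add_mono mult_right_mono) auto
    finally show "norm (\<mu> (Suc k) * (norm (y (Suc (Suc k)) - y (Suc k)))\<^sup>2) \<le>
        3 * (\<mu> (Suc k) * (norm (Y (Suc k) - Y k))\<^sup>2 + \<mu> 0 * (\<delta> (Suc k))\<^sup>2 + \<mu> 0 * (\<delta> k)\<^sup>2)"
      using mu(1)[of "Suc k"] by simp
  qed
  then show ?thesis by (subst (asm) summable_Suc_iff[of "\<lambda>k. \<mu> k * (norm (y (Suc k) - y k))\<^sup>2"])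
qed

lemma inexact_prox_gradient_accumulation_point:
  fixes D :: "'a::euclidean_space \<Rightarrow> ereal"
  assumes S: "compact S" "convex S" "S \<noteq> {}" and mu: "\<And>k. 0 < \<mu> k" "\<mu> \<longlonglongrightarrow> m"
    and closed: "\<And>s l M a. \<lbrakk>s \<longlonglongrightarrow> l; M \<longlonglongrightarrow> a; \<And>n. D (s n) \<le> ereal (M n)\<rbrakk> \<Longrightarrow> D l \<le> ereal a"
    and nMInf: "\<And>v. D v \<noteq> -\<infinity>"
    and yh: "\<And>k. yh k = closest_point S (y k)"
    and D: "\<And>k. D (Y k) = ereal (d k)"
    and sub: "\<And>k v. ereal (d k + \<mu> k * ((v - Y k) \<bullet> (yh k - Y k))) \<le> D v"
    and near: "(\<lambda>k. y (Suc k) - Y k) \<longlonglongrightarrow> 0"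
    and diff: "(\<lambda>k. \<mu> k *\<^sub>R (y (Suc k) - y k)) \<longlonglongrightarrow> 0"
    and acc: "accumulation_point y ybar"
  shows "is_minimizer (\<lambda>v. D v + ereal (m / 2 * (infdist v S)\<^sup>2)) ybar"
proof -
  have Sc: "closed S" using S by (simp add: compact_imp_closed)
  have m0: "0 \<le> m" using mu less_imp_le by (intro LIMSEQ_le_const[of \<mu> m 0]) blast+
  obtain r where r: "strict_mono r" "(y \<circ> r) \<longlonglongrightarrow> ybar"
    using acc unfolding accumulation_point_def by blast
  \<comment> \<open>The bound in \<open>near\<close> pairs \<open>Y (k n)\<close> with
    \<open>y (Suc (k n))\<close>, so the subsequence is shifted back by one. Starting from
    \<open>r (Suc n)\<close>, which is positive, ensures a genuine predecessor.\<close>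
  define k where "k n = r (Suc n) - 1" for n
  have Suck: "Suc (k n) = r (Suc n)" for n
    using seq_suble[OF r(1), of "Suc n"] by (simp add: k_def)
  have k_top: "filterlim k at_top sequentially"
  proof (rule filterlim_at_top_mono[OF filterlim_ident])
    show "\<forall>\<^sub>F n in sequentially. n \<le> k n"
      using seq_suble[OF r(1)] Suck by (metis (mono_tags) Suc_le_mono always_eventually)
  qed
  have yk: "(\<lambda>n. y (Suc (k n))) \<longlonglongrightarrow> ybar"
    using LIMSEQ_Suc[OF r(2)] by (simp add: Suck)
  have muk: "(\<lambda>n. \<mu> (k n)) \<longlonglongrightarrow> m" by (rule filterlim_compose[OF mu(2) k_top])
  have Yk: "(\<lambda>n. Y (k n)) \<longlonglongrightarrow> ybar"
    using tendsto_diff[OF yk filterlim_compose[OF near k_top]] by simp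
  have key: "D ybar \<le> ereal (a - m * ((v - ybar) \<bullet> (closest_point S ybar - ybar)))" if a: "D v = ereal a" for v a
  proof (cases "m = 0")
    case True
    \<comment> \<open>With a vanishing penalty the points \<open>yh (k n)\<close> need not converge.
      They stay in the bounded set \<open>S\<close>, so the inner product term is at most
      \<open>C\<^sup>2 / 2\<close> times the penalty parameter and disappears in the limit.\<close>
    obtain C where C: "\<And>w. w \<in> S \<Longrightarrow> norm (v - w) \<le> C"
    proof -
      obtain C where "\<forall>w\<in>S. norm w \<le> C" using S(1) compact_imp_bounded bounded_iff by blast
      then have "norm (v - w) \<le> norm v + C" if "w \<in> S" for w
        using that norm_triangle_ineq4[of v w] by force
      then show thesis using that by blast
    qed
    have "D ybar \<le> ereal (a + m / 2 * C\<^sup>2)"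
    proof (rule closed[OF Yk])
      show "(\<lambda>n. a + \<mu> (k n) / 2 * C\<^sup>2) \<longlonglongrightarrow> a + m / 2 * C\<^sup>2"
        by (intro tendsto_intros muk) simp
      show "D (Y (k n)) \<le> ereal (a + \<mu> (k n) / 2 * C\<^sup>2)" for n
      proof -
        let ?k = "k n"
        have "norm (v - yh ?k) \<le> C" unfolding yh by (intro C closest_point_in_set Sc S)
        then have "(norm (v - yh ?k))\<^sup>2 \<le> C\<^sup>2" by (rule power_mono) simp
        moreover have "- 2 * ((v - Y ?k) \<bullet> (yh ?k - Y ?k)) =
            (norm (v - yh ?k))\<^sup>2 - (norm (yh ?k - Y ?k))\<^sup>2 - (norm (v - Y ?k))\<^sup>2"
          unfolding power2_norm_eq_inner by (simp add: inner_diff_left inner_diff_right inner_commute)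
        ultimately have "- 2 * ((v - Y ?k) \<bullet> (yh ?k - Y ?k)) \<le> C\<^sup>2"
          using zero_le_power2[of "norm (yh ?k - Y ?k)"] zero_le_power2[of "norm (v - Y ?k)"] by linarith
        then have "\<mu> ?k / 2 * (- 2 * ((v - Y ?k) \<bullet> (yh ?k - Y ?k))) \<le> \<mu> ?k / 2 * C\<^sup>2"
          using mu(1)[of ?k] by (intro mult_left_mono) auto
        then show ?thesis using sub[of ?k v] a D[of ?k] by simp
      qed
    qed
    then show ?thesis using True by simp
  next
    case False
    \<comment> \<open>A positive limit allows division by \<open>\<mu> k\<close>. Hence
      \<open>y (k n)\<close> has the same limit as \<open>y (Suc (k n))\<close>, and continuity of
      the projection identifies the limit of \<open>yh (k n)\<close>.\<close>
    have "(\<lambda>k. inverse (\<mu> k) *\<^sub>R (\<mu> k *\<^sub>R (y (Suc k) - y k))) \<longlonglongrightarrow> inverse m *\<^sub>R 0"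
      by (intro tendsto_intros mu(2) diff False)
    then have "(\<lambda>k. y (Suc k) - y k) \<longlonglongrightarrow> 0" using mu(1) by (simp add: less_imp_neq[THEN not_sym])
    then have "(\<lambda>n. y (Suc (k n)) - y (k n)) \<longlonglongrightarrow> 0" by (rule filterlim_compose[OF _ k_top])
    from tendsto_diff[OF yk this] have "(\<lambda>n. y (k n)) \<longlonglongrightarrow> ybar" by simp
    then have yhk: "(\<lambda>n. yh (k n)) \<longlonglongrightarrow> closest_point S ybar"
      unfolding yh using continuous_at_closest_point[OF S(2) Sc S(3)] isCont_tendsto_compose by blast
    show ?thesis
    proof (rule closed[OF Yk])
      show "(\<lambda>n. a - \<mu> (k n) * ((v - Y (k n)) \<bullet> (yh (k n) - Y (k n)))) \<longlonglongrightarrow>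
          a - m * ((v - ybar) \<bullet> (closest_point S ybar - ybar))"
        by (intro tendsto_intros muk Yk yhk)
      show "D (Y (k n)) \<le> ereal (a - \<mu> (k n) * ((v - Y (k n)) \<bullet> (yh (k n) - Y (k n))))" for n
        using sub[of "k n" v] a D[of "k n"] by simp
    qed
  qed
  \<comment> \<open>Finiteness at \<open>ybar\<close> comes from \<open>key\<close> applied to
    \<open>Y 0\<close>, a point where \<open>D\<close> is finite.\<close>
  obtain b where b: "D ybar = ereal b"
    using key[OF D[of 0]] nMInf[of ybar] by (cases "D ybar") auto
  have "D ybar + ereal (m / 2 * (infdist ybar S)\<^sup>2) \<le> D v + ereal (m / 2 * (infdist v S)\<^sup>2)" for v
  proof (cases "D v")
    case (real a)
    \<comment> \<open>The inner product here is the negative of the one in \<open>key\<close>, so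
      adding the two inequalities gives minimality.\<close>
    have "m / 2 * ((infdist ybar S)\<^sup>2 + 2 * ((v - ybar) \<bullet> (ybar - closest_point S ybar))) \<le> m / 2 * (infdist v S)\<^sup>2"
      using infdist_square_subgradient[OF Sc S(2,3)] m0 by (intro mult_left_mono) auto
    then show ?thesis using key[OF real] b real by (simp add: algebra_simps inner_diff_right)
  qed (use nMInf in auto)
  then show ?thesis unfolding is_minimizer_def effdom_def using b by simp
qed

section \<open>The safeguarded augmented Lagrangian method\<close>

theorem lemma5p2:
  fixes f :: "real ^ 'n \<Rightarrow> real"
    and g :: "real ^ 'm \<Rightarrow> ereal"
    and c :: "real ^ 'n \<Rightarrow> real ^ 'm"
    and S :: "(real ^ 'm) set"
    and \<beta> :: real
    and x :: "nat \<Rightarrow> real ^ 'n"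
    and z y yh :: "nat \<Rightarrow> real ^ 'm"
    and \<epsilon> \<mu> :: "nat \<Rightarrow> real"
  assumes f: "cont_differentiable f" "convex_on UNIV f"
    and g: "proper_fun g" "lsc_fun g" "convex_fun g"
    and c: "cont_differentiable c" "neg_cone_convex (hzn g) c"
    and feasible: "effdom (composite_obj f g c) \<noteq> {}"
    and minimizer: "\<exists>x0. is_minimizer (composite_obj f g c) x0"
    and V: "proper_fun (value_fun f g c)" "lsc_fun (value_fun f g c)"
    and alm: "safeguarded_alm f g c S \<beta> x z y yh \<epsilon> \<mu>"
    and eps: "summable (\<lambda>k. sqrt (\<epsilon> k / \<mu> k))"
  shows "summable (\<lambda>k. \<mu> k * (norm (y (Suc k) - y k))\<^sup>2) \<and>
    summable (\<lambda>k. \<mu> k * (norm (yh (Suc k) - yh k))\<^sup>2) \<and>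
    (\<lambda>k. \<mu> k *\<^sub>R (y (Suc k) - y k)) \<longlonglongrightarrow> 0 \<and>
    (\<lambda>k. \<mu> k *\<^sub>R (yh (Suc k) - yh k)) \<longlonglongrightarrow> 0 \<and>
    decseq \<mu> \<and>
    (\<exists>\<mu>lim \<ge> 0. \<mu> \<longlonglongrightarrow> \<mu>lim \<and>
       convex_fun (penalized_dual_obj f g c S \<mu>lim) \<and>
       (\<forall>ybar. accumulation_point y ybar \<longrightarrow>
          is_minimizer (penalized_dual_obj f g c S \<mu>lim) ybar))"
proof -
  let ?D = "\<lambda>v. - dual_fun f g c v" and ?\<delta> = "\<lambda>k. sqrt 2 * sqrt (\<epsilon> k / \<mu> k)"
  have S: "compact S" "convex S" "S \<noteq> {}" and \<beta>: "\<beta> < 1" and \<mu>0: "0 < \<mu> 0"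
    and yh: "\<And>k. yh k = closest_point S (y k)" and \<epsilon>: "\<And>k. 0 \<le> \<epsilon> k"
    and opt: "\<And>k. aug_lagrangian f g c (\<mu> k) (x k) (yh k)
        \<le> (INF x'. aug_lagrangian f g c (\<mu> k) x' (yh k)) + ereal (\<epsilon> k)"
    and z: "\<And>k. z k = prox (\<lambda>w. ereal (\<mu> k) * g w) (c (x k) + \<mu> k *\<^sub>R yh k)"
    and y: "\<And>k. y (Suc k) = yh k + (1 / \<mu> k) *\<^sub>R (c (x k) - z k)"
    and \<mu>_step: "\<And>k. \<exists>\<beta>k \<in> {0<..\<beta>} \<union> {1}. \<mu> (Suc k) = \<beta>k * \<mu> k"
    using alm unfolding safeguarded_alm_def by blast+
  have Sc: "closed S" using S by (simp add: compact_imp_closed)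
  have \<mu>: "0 < \<mu> k" for k
  proof (induction k)
    case (Suc k)
    then show ?case using \<mu>_step[of k] by auto
  qed (rule \<mu>0)
  have dec: "decseq \<mu>"
    unfolding decseq_Suc_iff
  proof
    fix k
    obtain b where b: "b \<in> {0<..\<beta>} \<union> {1}" "\<mu> (Suc k) = b * \<mu> k" using \<mu>_step by blast
    then have "b * \<mu> k \<le> 1 * \<mu> k" using \<beta> \<mu>[of k] by (intro mult_right_mono) auto
    then show "\<mu> (Suc k) \<le> \<mu> k" using b by simp
  qed
  obtain m where m: "\<mu> \<longlonglongrightarrow> m" "0 \<le> m"
  proof -
    obtain m where m: "\<mu> \<longlonglongrightarrow> m"
      using decseq_convergent[OF dec, of 0] \<mu> less_imp_le by metis
    moreover have "0 \<le> m" using m \<mu> less_imp_le by (intro LIMSEQ_le_const[of \<mu> m 0]) blast+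
    ultimately show thesis using that by blast
  qed
  have "\<exists>ybar d. ?D ybar = ereal d \<and>
      (\<forall>v. ereal (d + \<mu> k * ((v - ybar) \<bullet> (yh k - ybar))) \<le> ?D v) \<and> norm (y (Suc k) - ybar) \<le> ?\<delta> k" for k
    unfolding y
    using alm_step[OF f(2) g c(2) V \<mu> \<epsilon> opt z, of k] by metis
  then obtain Y d where D: "\<And>k. ?D (Y k) = ereal (d k)"
    and sub: "\<And>k v. ereal (d k + \<mu> k * ((v - Y k) \<bullet> (yh k - Y k))) \<le> ?D v"
    and near: "\<And>k. norm (y (Suc k) - Y k) \<le> ?\<delta> k"
    by metis
  have \<delta>: "summable ?\<delta>" using eps by (intro summable_mult)
  \<comment> \<open>Feasibility and properness make the value at 0 finite, and weak duality at 0
    bounds \<open>-d\<close> below by its negative.\<close>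
  obtain b where b: "\<And>v. ereal b \<le> ?D v"
  proof -
    obtain x0 where "composite_obj f g c x0 < \<infinity>" using feasible unfolding effdom_def by blast
    moreover have "value_fun f g c 0 \<le> composite_obj f g c x0"
      unfolding value_fun_def composite_obj_def by (intro INF_lower2[of x0]) auto
    ultimately have "value_fun f g c 0 < \<infinity>" by (rule le_less_trans[rotated])
    then obtain r where "value_fun f g c 0 = ereal r" using proper_fun_real[OF V(1)] by blast
    from uminus_dual_fun_ge_value_fun[OF g(1) this] show thesis using that[of "- r"] by simp
  qed
  have sum_y: "summable (\<lambda>k. \<mu> k * (norm (y (Suc k) - y k))\<^sup>2)"
  proof (rule inexact_prox_gradient_summable[OF Sc S(2,3) \<mu> dec _ _ near \<delta>])
    show "b \<le> d k" for k using b[of "Y k"] by (simp add: D)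
    show "d (Suc k) + \<mu> (Suc k) * ((Y k - Y (Suc k)) \<bullet> (closest_point S (y (Suc k)) - Y (Suc k))) \<le> d k" for k
      using sub[of "Suc k" "Y k"] by (simp add: D yh)
  qed
  have sum_yh: "summable (\<lambda>k. \<mu> k * (norm (yh (Suc k) - yh k))\<^sup>2)"
  proof (rule summable_comparison_test'[OF sum_y])
    fix k
    have "norm (yh (Suc k) - yh k) \<le> norm (y (Suc k) - y k)"
      using closest_point_lipschitz[OF S(2) Sc S(3), of "y (Suc k)" "y k"] by (simp add: yh dist_norm)
    then have "(norm (yh (Suc k) - yh k))\<^sup>2 \<le> (norm (y (Suc k) - y k))\<^sup>2" by (rule power_mono) simp
    then show "norm (\<mu> k * (norm (yh (Suc k) - yh k))\<^sup>2) \<le> \<mu> k * (norm (y (Suc k) - y k))\<^sup>2"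
      using \<mu>[of k] by simp
  qed
  have diff: "(\<lambda>k. \<mu> k *\<^sub>R (y (Suc k) - y k)) \<longlonglongrightarrow> 0"
    by (rule tendsto_scaleR_of_summable_weighted_squares[OF sum_y \<mu> dec])
  have near_0: "(\<lambda>k. y (Suc k) - Y k) \<longlonglongrightarrow> 0"
    by (rule Lim_null_comparison[OF _ summable_LIMSEQ_zero[OF \<delta>]]) (use near in simp)
  have "is_minimizer (penalized_dual_obj f g c S m) ybar" if "accumulation_point y ybar" for ybar
    unfolding penalized_dual_obj_def
    using inexact_prox_gradient_accumulation_point[OF S \<mu> m(1) uminus_dual_fun_le_limit[OF g(1)]
        uminus_dual_fun_not_MInf[OF g(1)] yh D sub near_0 diff that] .
  then show ?thesis
    using sum_y sum_yh diff tendsto_scaleR_of_summable_weighted_squares[OF sum_yh \<mu> dec] dec m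
      convex_fun_penalized_dual_obj[OF g(1) Sc S(2,3) m(2)] by blast
qed

end
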